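(* Let $n\ge 1$ and let $\Gamma>1$. Then $$\mathfrak{N}_{\mathcal{M}}(\sigma,\omega)\;\approx\;\mathfrak{T}_{\mathcal{M}}(\Gamma)(\sigma,\omega)+\sqrt{A_{2}(\sigma,\omega)}$$ for all pairs $(\sigma,\omega)$ of locally finite positive Borel measures on $\mathbb{R}^{n}$, where the implicit constants of comparability depend on both $\Gamma$ and the dimension $n$ (only); that is, there is a constant $C\ge 1$ depending only on $\Gamma$ and $n$ such that for all such pairs, $$C^{-1}\,\mathfrak{N}_{\mathcal{M}}(\sigma,\omega)\le \mathfrak{T}_{\mathcal{M}}(\Gamma)(\sigma,\omega)+\sqrt{A_{2}(\sigma,\omega)}\le C\,\mathfrak{N}_{\mathcal{M}}(\sigma,\omega).$$
   Context: Notation. $\mathcal{P}^{n}$ is the collection of cubes in $\mathbb{R}^{n}$ with sides parallel to the coordinate axes whose side length $\ell(Q)$ is an integral power of $2$ (i.e. $\ell(Q)\in\{2^{\ell}\}_{\ell\in\mathbb{Z}}$). For $Q\in\mathcal{P}^n$ and $\Gamma\ge 1$, $\Gamma Q$ is the cube concentric with $Q$ with side length $\Gamma\ell(Q)$. $|E|$ is the Lebesgue measure of $E$, and for a positive Borel measure $\mu$, $|E|_{\mu}=\mu(E)=\int_E d\mu$. For a locally finite signed measure $\mu$ on $\mathbb{R}^{n}$ (its total variation $|\mu|$ is locally finite), the maximal function is $$\mathcal{M}\mu(x)=\sup_{Q\in\mathcal{P}^{n}:\,x\in Q}\frac{1}{|Q|}\int_{Q}d|\mu|,\qquad x\in\mathbb{R}^n.$$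 For a function $f$ and a measure $\sigma$, $f\sigma$ denotes the measure with density $f$ with respect to $\sigma$. For locally finite positive Borel measures $\sigma,\omega$ on $\mathbb{R}^{n}$ define the following quantities in $[0,\infty]$ (each best constant being $\infty$ if no finite constant exists): (1) $\mathfrak{N}_{\mathcal{M}}(\sigma,\omega)$ is the best constant in $$\int_{\mathbb{R}^{n}}|\mathcal{M}(f\sigma)|^{2}\,d\omega\le \mathfrak{N}_{\mathcal{M}}(\sigma,\omega)^{2}\int_{\mathbb{R}^{n}}|f|^{2}\,d\sigma\quad\text{for all } f\in L^{2}(\sigma).$$ (2) For $\Gamma>1$, the $\Gamma$-testing constant $\mathfrak{T}_{\mathcal{M}}(\Gamma)(\sigma,\omega)$ is the least constant such that $$\int_{Q}|\mathcal{M}(\mathbf{1}_{Q}\sigma)|^{2}\,d\omega\le \mathfrak{T}_{\mathcal{M}}(\Gamma)(\sigma,\omega)^{2}\,|\Gamma Q|_{\sigma}\quad\text{for all } Q\in\mathcal{P}^{n}.$$ (3) The Muckenhoupt constant is $$A_{2}(\sigma,\omega)=\sup_{Q\in\mathcal{P}^{n}}\left(\frac{1}{|Q|}\int_{Q}d\sigma\right)\left(\frac{1}{|Q|}\int_{Q}d\omega\right).$$ *)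

theory Defs
  imports "HOL-Analysis.Analysis"
begin

definition locally_finite_borel :: "(real ^ 'n) measure \<Rightarrow> bool" where
  "locally_finite_borel \<mu> \<longleftrightarrow>
     sets \<mu> = sets borel \<and> (\<forall>x. \<exists>U. open U \<and> x \<in> U \<and> emeasure \<mu> U < \<infinity>)"

text \<open>Cubes are closed. With this convention the dilate of \<open>cube c l\<close> by \<open>\<Gamma>\<close> is
  \<open>cube c (\<Gamma> * l)\<close>; for \<open>l > 0\<close> the set determines both its centre \<open>c\<close> and its side length \<open>l\<close>.\<close>

definition cube :: "real ^ 'n \<Rightarrow> real \<Rightarrow> (real ^ 'n) set" where
  "cube c l = cbox (c - (\<chi> i. l / 2)) (c + (\<chi> i. l / 2))"

definition pow2_cubes :: "(real ^ 'n) set set" where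
  "pow2_cubes = {cube c (2 powi k) | (c :: real ^ 'n) (k :: int). True}"

text \<open>A locally finite signed measure is represented by its real values on bounded Borel sets
  (on unbounded sets it need not be defined, and values there are never used).\<close>

definition weighted :: "(real ^ 'n \<Rightarrow> real) \<Rightarrow> (real ^ 'n) measure \<Rightarrow> (real ^ 'n) set \<Rightarrow> real" where
  "weighted f \<sigma> E = (LINT x:E|\<sigma>. f x)"

definition total_variation :: "((real ^ 'n) set \<Rightarrow> real) \<Rightarrow> (real ^ 'n) set \<Rightarrow> ennreal" where
  "total_variation \<mu> E =
     (SUP P \<in> {P. finite P \<and> P \<subseteq> sets borel \<and> disjoint P \<and> \<Union>P = E}.
        \<Sum>A\<in>P. ennreal \<bar>\<mu> A\<bar>)"

definition maximal_function :: "((real ^ 'n) set \<Rightarrow> real) \<Rightarrow> real ^ 'n \<Rightarrow> ennreal" where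
  "maximal_function \<mu> x =
     (SUP Q \<in> {Q \<in> pow2_cubes. x \<in> Q}. total_variation \<mu> Q / emeasure lborel Q)"

definition L2 :: "(real ^ 'n) measure \<Rightarrow> (real ^ 'n \<Rightarrow> real) set" where
  "L2 \<sigma> = {f. f \<in> borel_measurable \<sigma> \<and> integrable \<sigma> (\<lambda>x. \<bar>f x\<bar>\<^sup>2)}"

text \<open>Best constants are infima over finite constants; the infimum of the empty set is \<open>\<infinity>\<close>.\<close>

definition norm_const :: "(real ^ 'n) measure \<Rightarrow> (real ^ 'n) measure \<Rightarrow> ennreal" where
  "norm_const \<sigma> \<omega> = Inf {ennreal C | C. 0 \<le> C \<and>
     (\<forall>f \<in> L2 \<sigma>. (\<integral>\<^sup>+x. (maximal_function (weighted f \<sigma>) x)\<^sup>2 \<partial>\<omega>)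
                   \<le> ennreal (C\<^sup>2) * (\<integral>\<^sup>+x. ennreal (\<bar>f x\<bar>\<^sup>2) \<partial>\<sigma>))}"

definition testing_const :: "real \<Rightarrow> (real ^ 'n) measure \<Rightarrow> (real ^ 'n) measure \<Rightarrow> ennreal" where
  "testing_const \<Gamma> \<sigma> \<omega> = Inf {ennreal C | C. 0 \<le> C \<and>
     (\<forall>(c :: real ^ 'n) (k :: int). let Q = cube c (2 powi k) in
        (\<integral>\<^sup>+x\<in>Q. (maximal_function (weighted (indicator Q) \<sigma>) x)\<^sup>2 \<partial>\<omega>)
          \<le> ennreal (C\<^sup>2) * emeasure \<sigma> (cube c (\<Gamma> * 2 powi k)))}"

definition A2_const :: "(real ^ 'n) measure \<Rightarrow> (real ^ 'n) measure \<Rightarrow> ennreal" where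
  "A2_const \<sigma> \<omega> =
     (SUP Q \<in> pow2_cubes. (emeasure \<sigma> Q / emeasure lborel Q) * (emeasure \<omega> Q / emeasure lborel Q))"

definition ennreal_sqrt :: "ennreal \<Rightarrow> ennreal" where
  "ennreal_sqrt a = (if a = \<infinity> then \<infinity> else ennreal (sqrt (enn2real a)))"

end

theory Submission
  imports Defs
begin

text \<open>
  That the norm constant dominates testing and \<open>\<surd>A\<^sub>2\<close> is seen by inserting \<open>f = 1\<^sub>Q\<close> and using
  \<open>M(1\<^sub>Q\<sigma>) \<ge> \<sigma>(Q) / |Q|\<close> on \<open>Q\<close>. The content is the other direction. It is trivial if
  \<open>A\<^sub>2 = \<infinity>\<close>; if \<open>A\<^sub>2 < \<infinity>\<close>, then the norm constant is at most a multiple of the \<open>\<Gamma>\<close>-testing constant \<open>T\<close>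
  (\<open>norm_bound_of_dilated_testing\<close>).

  Finitely many shifted dyadic grids dominate \<open>M\<close>, so it suffices to treat the maximal function
  over one grid, truncated to finitely many scales. Choosing for every point \<open>x\<close> a cell that attains
  the maximum cuts space into disjoint pieces \<open>E\<^sub>Q \<subseteq> Q\<close>, and the integral to be bounded becomes
  \<open>\<Sum>\<^sub>Q \<tau>\<^sub>Q (\<sigma>-average of f over Q)\<^sup>2\<close> with \<open>\<tau>\<^sub>Q = \<omega>(E\<^sub>Q) (\<sigma>(Q) / |Q|)\<^sup>2\<close>. By the Carleson
  embedding theorem (\<open>carleson_embedding\<close>) this is at most a multiple of the integral of \<open>f\<^sup>2\<close> against
  \<open>\<sigma>\<close> as soon as \<open>\<Sum>\<^bsub>Q \<subseteq> P\<^esub> \<tau>\<^sub>Q \<lesssim> \<sigma>(P)\<close> for all cells \<open>P\<close>. Testing on \<open>P\<close> itself would give this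
  at once, but only with the possibly much larger \<open>\<sigma>(\<Gamma>P)\<close> on the right.

  The packing condition is nevertheless true (\<open>dilated_testing_imp_packing\<close>). Let \<open>G = 2\<^sup>g \<ge> \<Gamma>\<close>. For
  every cell \<open>Q\<close> charged by both measures there is a least \<open>j\<close> for which the dilate \<open>K = G\<^sup>j Q\<close> is doubling,
  \<open>\<sigma>(GK) \<le> D \<sigma>(K)\<close>: otherwise \<open>\<sigma>(G\<^sup>j Q)\<close> would grow faster than the finiteness of \<open>A\<^sub>2\<close> permits.
  Group the cells by \<open>j\<close> and by the size of the ratio \<open>\<theta> = \<sigma>(Q) / \<sigma>(K)\<close>, up to a factor two; by
  minimality \<open>\<theta> \<le> D\<^sup>-\<^sup>j\<close>. For a maximal cell \<open>Q\<close> of one group, test on the doubling cube \<open>K\<close>. The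
  cells \<open>Q'\<close> of the same group inside \<open>Q\<close> have dilates \<open>K' = G\<^sup>j Q' \<subseteq> K\<close>, hence the sum of
  \<open>\<omega>(E\<^bsub>Q'\<^esub>) (\<sigma>(K') / |K'|)\<^sup>2\<close> is at most \<open>T\<^sup>2 \<sigma>(\<Gamma>K) \<le> T\<^sup>2 D \<sigma>(K) \<approx> T\<^sup>2 D \<theta>\<^sup>-\<^sup>1 \<sigma>(Q)\<close>. Passing from
  \<open>\<sigma>(K') / |K'|\<close> back to \<open>\<sigma>(Q') / |Q'|\<close> gains \<open>\<theta>\<^sup>2\<close> and costs \<open>G\<^sup>2\<^sup>n\<^sup>j\<close>. The total \<open>T\<^sup>2 D \<theta> G\<^sup>2\<^sup>n\<^sup>j \<sigma>(Q)\<close>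
  is summable over the groups once \<open>D = 2 G\<^sup>2\<^sup>n\<close>: the square in \<open>\<theta>\<^sup>2\<close> pays for the loss in testing.
\<close>

section \<open>Laminar families and their maximal members\<close>

text \<open>The combinatorics of dyadic cubes that the proof uses. Finiteness at each point replaces a bound
  on the scales; it is what makes maximal members exist and maxima be attained.\<close>

definition laminar :: "'a set set \<Rightarrow> bool" where
  "laminar \<Q> \<longleftrightarrow> countable \<Q> \<and> {} \<notin> \<Q> \<and> (\<forall>x. finite {Q \<in> \<Q>. x \<in> Q}) \<and>
     (\<forall>Q\<in>\<Q>. \<forall>R\<in>\<Q>. Q \<inter> R = {} \<or> Q \<subseteq> R \<or> R \<subseteq> Q)"

lemma laminarD:
  assumes "laminar \<Q>"
  shows "countable \<Q>" "{} \<notin> \<Q>" "finite {Q \<in> \<Q>. x \<in> Q}"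
    "Q \<in> \<Q> \<Longrightarrow> R \<in> \<Q> \<Longrightarrow> Q \<inter> R = {} \<or> Q \<subseteq> R \<or> R \<subseteq> Q"
  using assms by (simp_all add: laminar_def)

lemma laminar_subset:
  assumes "laminar \<Q>" "\<S> \<subseteq> \<Q>"
  shows "laminar \<S>"
  unfolding laminar_def
proof (intro conjI allI)
  show "countable \<S>" using laminarD(1)[OF assms(1)] assms(2) by (rule countable_subset[rotated])
  show "{} \<notin> \<S>" using laminarD(2)[OF assms(1)] assms(2) by auto
  show "finite {Q \<in> \<S>. x \<in> Q}" for x
    by (rule finite_subset[of _ "{Q \<in> \<Q>. x \<in> Q}"]) (use laminarD(3)[OF assms(1)] assms(2) in auto)
  show "\<forall>Q\<in>\<S>. \<forall>R\<in>\<S>. Q \<inter> R = {} \<or> Q \<subseteq> R \<or> R \<subseteq> Q"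
    using laminarD(4)[OF assms(1)] assms(2) by (simp add: subset_iff)
qed

lemma laminar_maximal_members:
  assumes "laminar \<S>"
  obtains \<M> where "\<M> \<subseteq> \<S>" "disjoint \<M>" "\<And>Q. Q \<in> \<S> \<Longrightarrow> \<exists>M\<in>\<M>. Q \<subseteq> M"
proof
  define \<M> where "\<M> = {M \<in> \<S>. \<forall>Q\<in>\<S>. M \<subseteq> Q \<longrightarrow> M = Q}"
  show "\<M> \<subseteq> \<S>" by (auto simp: \<M>_def)
  show "disjoint \<M>"
    unfolding disjoint_def
  proof (intro ballI impI)
    fix M M' assume "M \<in> \<M>" "M' \<in> \<M>" "M \<noteq> M'"
    then have M: "M \<in> \<S>" "M' \<in> \<S>" "\<not> M \<subseteq> M'" "\<not> M' \<subseteq> M"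
      by (auto simp: \<M>_def)
    then show "M \<inter> M' = {}" using laminarD(4)[OF assms M(1,2)] by simp
  qed
  fix Q assume Q: "Q \<in> \<S>"
  have "Q \<noteq> {}" using Q laminarD(2)[OF assms] by metis
  then obtain x where x: "x \<in> Q" by (metis ex_in_conv)
  have "finite {R \<in> \<S>. Q \<subseteq> R}"
    by (rule finite_subset[of _ "{R \<in> \<S>. x \<in> R}"]) (use laminarD(3)[OF assms] x in auto)
  then obtain M where "M \<in> {R \<in> \<S>. Q \<subseteq> R}" "\<forall>R\<in>{R \<in> \<S>. Q \<subseteq> R}. M \<subseteq> R \<longrightarrow> M = R"
    using finite_has_maximal2[of "{R \<in> \<S>. Q \<subseteq> R}" Q] Q by auto
  then show "\<exists>M\<in>\<M>. Q \<subseteq> M"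
    unfolding \<M>_def by (intro bexI[of _ M] CollectI conjI ballI impI) auto
qed

lemma nn_integral_count_space_restrict:
  assumes "\<S> \<subseteq> \<Q>"
  shows "(\<integral>\<^sup>+q. \<tau> q * indicator \<S> q \<partial>count_space \<Q>) = (\<integral>\<^sup>+q. \<tau> q \<partial>count_space \<S>)"
  using assms by (subst nn_integral_restrict_space[symmetric])
    (auto simp: restrict_count_space Int_absorb1 Int_absorb2)

text \<open>A bound for the sum below each member globalises, because the members below different maximal
  members are different and the maximal members themselves are disjoint.\<close>

lemma laminar_sum_le_emeasure:
  fixes \<tau> :: "'a set \<Rightarrow> ennreal"
  assumes lam: "laminar \<S>" and sets: "\<S> \<subseteq> sets \<mu>"
    and local: "\<And>M. M \<in> \<S> \<Longrightarrow> (\<integral>\<^sup>+Q. \<tau> Q \<partial>count_space {Q \<in> \<S>. Q \<subseteq> M}) \<le> c * emeasure \<mu> M"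
  shows "(\<integral>\<^sup>+Q. \<tau> Q \<partial>count_space \<S>) \<le> c * emeasure \<mu> (\<Union>\<S>)"
proof -
  obtain \<M> where \<M>: "\<M> \<subseteq> \<S>" "disjoint \<M>" "\<And>Q. Q \<in> \<S> \<Longrightarrow> \<exists>M\<in>\<M>. Q \<subseteq> M"
    using laminar_maximal_members[OF lam] by blast
  have cS: "countable \<S>" using lam by (simp add: laminar_def)
  have cM: "countable \<M>" using cS \<M>(1) by (rule countable_subset[rotated])
  have "(\<integral>\<^sup>+Q. \<tau> Q \<partial>count_space \<S>)
      \<le> (\<integral>\<^sup>+Q. (\<integral>\<^sup>+M. \<tau> Q * indicator {R. R \<subseteq> M} Q \<partial>count_space \<M>) \<partial>count_space \<S>)"
  proof (rule nn_integral_mono)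
    fix Q assume "Q \<in> space (count_space \<S>)"
    then obtain M where M: "M \<in> \<M>" "Q \<subseteq> M" using \<M>(3) by auto
    then show "\<tau> Q \<le> (\<integral>\<^sup>+M. \<tau> Q * indicator {R. R \<subseteq> M} Q \<partial>count_space \<M>)"
      using nn_integral_ge_point[OF M(1), of "\<lambda>M. \<tau> Q * indicator {R. R \<subseteq> M} Q"] by simp
  qed
  also have "\<dots> = (\<integral>\<^sup>+M. (\<integral>\<^sup>+Q. \<tau> Q * indicator {R. R \<subseteq> M} Q \<partial>count_space \<S>) \<partial>count_space \<M>)"
    by (rule nn_integral_count_space_nn_integral) (auto simp: cM)
  also have "\<dots> = (\<integral>\<^sup>+M. (\<integral>\<^sup>+Q. \<tau> Q \<partial>count_space {Q \<in> \<S>. Q \<subseteq> M}) \<partial>count_space \<M>)"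
  proof (rule nn_integral_cong)
    fix M
    have "(\<integral>\<^sup>+Q. \<tau> Q * indicator {R. R \<subseteq> M} Q \<partial>count_space \<S>) = 
      (\<integral>\<^sup>+Q. \<tau> Q * indicator {Q \<in> \<S>. Q \<subseteq> M} Q \<partial>count_space \<S>)"
      by (rule nn_integral_cong) (auto simp: indicator_def)
    also have "\<dots> = (\<integral>\<^sup>+Q. \<tau> Q \<partial>count_space {Q \<in> \<S>. Q \<subseteq> M})"
      by (rule nn_integral_count_space_restrict) auto
    finally show "(\<integral>\<^sup>+Q. \<tau> Q * indicator {R. R \<subseteq> M} Q \<partial>count_space \<S>)
      = (\<integral>\<^sup>+Q. \<tau> Q \<partial>count_space {Q \<in> \<S>. Q \<subseteq> M})" .
  qed
  also have "\<dots> \<le> (\<integral>\<^sup>+M. c * emeasure \<mu> M \<partial>count_space \<M>)"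
    by (rule nn_integral_mono) (use local \<M>(1) in auto)
  also have "\<dots> = c * (\<integral>\<^sup>+M. emeasure \<mu> M \<partial>count_space \<M>)"
    by (rule nn_integral_cmult) auto
  also have "(\<integral>\<^sup>+M. emeasure \<mu> M \<partial>count_space \<M>) = emeasure \<mu> (\<Union>\<M>)"
  proof -
    have "disjoint_family_on (\<lambda>x. x) \<M>"
      using \<M>(2) unfolding disjoint_family_on_def disjoint_def by blast
    then show ?thesis
      using emeasure_UN_countable[of \<M> "\<lambda>x. x" \<mu>] \<M>(1) sets cM by (auto simp: subset_iff)
  qed
  also have "\<dots> \<le> emeasure \<mu> (\<Union>\<S>)"
    using \<M>(1) cS sets by (intro emeasure_mono) auto
  finally show ?thesis by (simp add: mult_left_mono)
qed

section \<open>The Carleson embedding theorem\<close>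

text \<open>A discrete layer cake formula: if \<open>m\<close> is positive and finite, the term with
  \<open>2\<^sup>i < m \<le> 2\<^sup>i\<^sup>+\<^sup>1\<close> alone is large enough. It trades
  the square of an average for a weighted count of the dyadic levels below it.\<close>

lemma square_le_dyadic_sum:
  fixes m :: ennreal
  shows "m\<^sup>2 \<le> (\<integral>\<^sup>+i. 4 * (ennreal (2 powi i))\<^sup>2 * indicator {i. ennreal (2 powi i) < m} i \<partial>count_space UNIV)"
    (is "_ \<le> ?S")
proof (cases m)
  case top
  have "of_nat k \<le> ?S" for k
  proof -
    have "k \<le> 2 ^ k" using less_exp[of k] by simp
    also have "(2::nat) ^ k \<le> (2 ^ k)\<^sup>2" by (rule self_le_power) auto
    finally have k: "k \<le> 4 * (2 ^ k)\<^sup>2" by simp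
    have "of_nat k \<le> 4 * (ennreal (2 powi int k))\<^sup>2"
    proof -
      have "(of_nat k::ennreal) \<le> of_nat (4 * (2^k)\<^sup>2)" using k by (simp only: of_nat_le_iff)
      also have "\<dots> = 4 * (ennreal (2 powi int k))\<^sup>2"
        by (simp add: ennreal_power[symmetric])
      finally show ?thesis .
    qed
    also have "\<dots> \<le> ?S"
      using nn_integral_ge_point[of "int k" UNIV "\<lambda>i. 4 * (ennreal (2 powi i))\<^sup>2 * indicator {i. ennreal (2 powi i) < m} i"]
      by (simp add: top)
    finally show ?thesis .
  qed
  then have "?S = top"
    by (metis ennreal_Ex_less_of_nat less_le_not_le top.not_eq_extremum)
  then show ?thesis by simp
next
  case (real t)
  show ?thesis
  proof (cases "t = 0")
    case True then show ?thesis using real by simp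
  next
    case False
    then have t: "t > 0" using real by simp
    define i where "i = \<lceil>log 2 t\<rceil> - 1"
    have pw: "2 powi j = 2 powr real_of_int j" for j by (simp add: powr_real_of_int')
    have "real_of_int i < log 2 t" "log 2 t \<le> real_of_int (i + 1)" unfolding i_def by linarith+
    then have i: "2 powi i < t" "t \<le> 2 powi (i + 1)"
      unfolding pw using t by (simp_all add: less_log_iff log_le_iff)
    have "t\<^sup>2 \<le> (2 * 2 powi i)\<^sup>2"
      using i(2) t by (intro power_mono) (auto simp: power_int_add)
    then have "m\<^sup>2 \<le> 4 * (ennreal (2 powi i))\<^sup>2"
      using t real by (simp add: ennreal_power ennreal_numeral[symmetric] ennreal_mult[symmetric] power_mult_distrib del: ennreal_numeral)
    also have "\<dots> \<le> ?S"
      using nn_integral_ge_point[of i UNIV "\<lambda>i. 4 * (ennreal (2 powi i))\<^sup>2 * indicator {i. ennreal (2 powi i) < m} i"] i(1) t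
      by (simp add: real ennreal_lessI)
    finally show ?thesis .
  qed
qed

text \<open>A geometric series: its largest term is less than \<open>2t\<close>.\<close>

lemma dyadic_sum_below_le:
  fixes t :: ennreal
  shows "(\<integral>\<^sup>+i. ennreal (2 powi i) * indicator {i. ennreal (2 powi i) < 2 * t} i \<partial>count_space UNIV) \<le> 4 * t"
proof (cases t)
  case top
  then show ?thesis by (simp add: ennreal_mult_top)
next
  case (real s)
  show ?thesis
  proof (cases "s = 0")
    case True then show ?thesis using real by simp
  next
    case False
    then have s: "s > 0" using real by simp
    define j where "j = \<lfloor>log 2 (2 * s)\<rfloor>"
    have pw: "2 powi j = 2 powr real_of_int j" for j by (simp add: powr_real_of_int')
    have j: "2 powi j \<le> 2 * s"
      unfolding pw j_def using s by (simp add: le_log_iff[symmetric])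
    have le_j: "i \<le> j" if "ennreal (2 powi i) < 2 * t" for i
    proof -
      have "ennreal (2 powi i) < ennreal (2 * s)" using that real by (simp add: ennreal_mult)
      then have "2 powi i < 2 * s" using s by (simp add: ennreal_less_iff)
      then have "real_of_int i < log 2 (2 * s)" unfolding pw using s by (simp add: less_log_iff)
      then show ?thesis unfolding j_def by linarith
    qed
    have "(\<integral>\<^sup>+i. ennreal (2 powi i) * indicator {i. ennreal (2 powi i) < 2 * t} i \<partial>count_space UNIV)
       \<le> (\<integral>\<^sup>+i. ennreal (2 powi i) * indicator {..j} i \<partial>count_space UNIV)"
      by (rule nn_integral_mono) (auto simp: indicator_def dest: le_j)
    also have "\<dots> = (\<integral>\<^sup>+i. ennreal (2 powi i) \<partial>count_space {..j})"
      by (rule nn_integral_count_space_restrict) auto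
    also have "\<dots> = (\<integral>\<^sup>+k. ennreal (2 powi (j - int k)) \<partial>count_space UNIV)"
    proof (rule nn_integral_bij_count_space[symmetric])
      show "bij_betw (\<lambda>k. j - int k) UNIV {..j}"
        by (rule bij_betwI[where g = "\<lambda>i. nat (j - i)"]) auto
    qed
    also have "\<dots> = (\<Sum>k. ennreal (2 powi j * (1/2)^k))"
      unfolding nn_integral_count_space_nat
      by (rule suminf_cong) (simp add: power_int_diff power_divide)
    also have "\<dots> = ennreal (2 powi j * 2)"
    proof (rule suminf_ennreal_eq)
      show "(\<lambda>k. 2 powi j * (1/2)^k) sums (2 powi j * (2::real))"
        using geometric_sums[of "1/2::real"] by (intro sums_mult) simp
    qed simp
    also have "\<dots> \<le> ennreal (4 * s)"
      using j by (intro ennreal_leI) simp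
    finally show ?thesis using real by (simp add: ennreal_mult)
  qed
qed

text \<open>Write \<open>m Q\<close> for the average of \<open>f\<close> over \<open>Q\<close>. If \<open>m Q > \<lambda>\<close>, then the part of \<open>f\<close> below \<open>\<lambda> / 2\<close>
  contributes at most half of this average, so \<open>\<lambda> \<sigma>(Q) / 2\<close> is at most the integral over \<open>Q\<close> of the part of
  \<open>f\<close> above \<open>\<lambda> / 2\<close>. Inserting this into the packing condition at the maximal members with \<open>m Q > \<lambda>\<close>
  bounds the sum of \<open>\<tau>\<close> over all members with \<open>m Q > \<lambda>\<close>. Summing over \<open>\<lambda> = 2\<^sup>i\<close> gives the square
  of \<open>f\<close> directly, without passing through the maximal inequality for \<open>\<sigma>\<close>.\<close>

theorem carleson_embedding:
  fixes f :: "'a \<Rightarrow> ennreal"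
  assumes lam: "laminar \<Q>" and sets: "\<Q> \<subseteq> sets \<sigma>"
    and fin: "\<And>Q. Q \<in> \<Q> \<Longrightarrow> emeasure \<sigma> Q < \<infinity>"
    and f[measurable]: "f \<in> borel_measurable \<sigma>"
    and packing: "\<And>P. P \<in> \<Q> \<Longrightarrow> (\<integral>\<^sup>+Q. \<tau> Q \<partial>count_space {Q \<in> \<Q>. Q \<subseteq> P}) \<le> c * emeasure \<sigma> P"
  shows "(\<integral>\<^sup>+Q. \<tau> Q * ((\<integral>\<^sup>+x\<in>Q. f x \<partial>\<sigma>) / emeasure \<sigma> Q)\<^sup>2 \<partial>count_space \<Q>)
           \<le> 32 * c * (\<integral>\<^sup>+x. (f x)\<^sup>2 \<partial>\<sigma>)"
proof -
  define m where "m Q = (\<integral>\<^sup>+x\<in>Q. f x \<partial>\<sigma>) / emeasure \<sigma> Q" for Q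
  define l where "l i = ennreal (2 powi i)" for i :: int
  \<comment> \<open>The part of \<open>f\<close> above half of the level \<open>2\<^sup>i\<close>, and \<open>2\<^sup>i < 2 f x\<close> is the form without division.\<close>
  define h where "h i x = f x * indicator {x. l i < 2 * f x} x" for i x
  have cQ: "countable \<Q>" using lam by (simp add: laminar_def)
  have l: "0 < l i" "l i < top" for i unfolding l_def by auto
  have h[measurable]: "h i \<in> borel_measurable \<sigma>" for i
    unfolding h_def by measurable
  have level: "(\<integral>\<^sup>+Q. \<tau> Q * indicator {Q. l i < m Q} Q \<partial>count_space \<Q>)
      \<le> c * (2 / l i) * (\<integral>\<^sup>+x. h i x \<partial>\<sigma>)" for i
  proof -
    define \<S> where "\<S> = {Q \<in> \<Q>. l i < m Q}"
    have \<S>: "\<S> \<subseteq> \<Q>" by (auto simp: \<S>_def)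
    have "(\<integral>\<^sup>+Q. \<tau> Q * indicator {Q. l i < m Q} Q \<partial>count_space \<Q>) = (\<integral>\<^sup>+Q. \<tau> Q * indicator \<S> Q \<partial>count_space \<Q>)"
      by (rule nn_integral_cong) (auto simp: \<S>_def indicator_def)
    also have "\<dots> = (\<integral>\<^sup>+Q. \<tau> Q \<partial>count_space \<S>)"
      using \<S> by (rule nn_integral_count_space_restrict)
    also have "\<dots> \<le> c * (2 / l i) * emeasure (density \<sigma> (h i)) (\<Union>\<S>)"
    proof (rule laminar_sum_le_emeasure)
      show "laminar \<S>" using lam \<S> by (rule laminar_subset)
      show "\<S> \<subseteq> sets (density \<sigma> (h i))" using \<S> sets by auto
      fix M assume M: "M \<in> \<S>"
      then have MQ: "M \<in> \<Q>" and Mm: "l i < m M" by (auto simp: \<S>_def)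
      have Ms[measurable]: "M \<in> sets \<sigma>" using MQ sets by auto
      have "(\<integral>\<^sup>+Q. \<tau> Q \<partial>count_space {Q \<in> \<S>. Q \<subseteq> M}) \<le> (\<integral>\<^sup>+Q. \<tau> Q \<partial>count_space {Q \<in> \<Q>. Q \<subseteq> M})"
        by (subst (1 2) nn_integral_count_space_indicator) (auto intro!: nn_integral_mono simp: indicator_def \<S>_def)
      also have "\<dots> \<le> c * emeasure \<sigma> M" by (rule packing[OF MQ])
      also have "emeasure \<sigma> M \<le> (2 / l i) * emeasure (density \<sigma> (h i)) M"
      proof -
        have ne: "emeasure \<sigma> M \<noteq> 0"
        proof
          assume "emeasure \<sigma> M = 0"
          then have "(\<integral>\<^sup>+x\<in>M. f x \<partial>\<sigma>) = 0" by (intro nn_integral_null_set) auto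
          then show False using Mm by (simp add: m_def)
        qed
        have dens: "emeasure (density \<sigma> (h i)) M = (\<integral>\<^sup>+x\<in>M. h i x \<partial>\<sigma>)"
          by (rule emeasure_density) auto
        have "l i * emeasure \<sigma> M \<le> (\<integral>\<^sup>+x\<in>M. f x \<partial>\<sigma>)"
        proof -
          have "l i * emeasure \<sigma> M \<le> m M * emeasure \<sigma> M" using Mm by (intro mult_right_mono) auto
          also have "\<dots> = (\<integral>\<^sup>+x\<in>M. f x \<partial>\<sigma>)" unfolding m_def
            using ne fin[OF MQ] by (simp add: ennreal_divide_times mult_divide_eq_ennreal)
          finally show ?thesis .
        qed
        also have "\<dots> \<le> (\<integral>\<^sup>+x. h i x * indicator M x + (l i / 2) * indicator M x \<partial>\<sigma>)"
        proof (rule nn_integral_mono)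
          fix x
          have "f x \<le> h i x + l i / 2"
          proof (cases "l i < 2 * f x")
            case True then show ?thesis by (simp add: h_def)
          next
            case False
            then have "2 * f x / 2 \<le> l i / 2" by (intro divide_right_mono_ennreal) auto
            then show ?thesis by (simp add: mult_divide_eq_ennreal mult.commute add_increasing)
          qed
          then show "f x * indicator M x \<le> h i x * indicator M x + (l i / 2) * indicator M x"
            by (auto simp: indicator_def)
        qed
        also have "\<dots> = (\<integral>\<^sup>+x\<in>M. h i x \<partial>\<sigma>) + (l i / 2) * emeasure \<sigma> M"
          by (subst nn_integral_add) (auto simp: nn_integral_cmult_indicator)
        finally have *: "l i * emeasure \<sigma> M \<le> (\<integral>\<^sup>+x\<in>M. h i x \<partial>\<sigma>) + (l i / 2) * emeasure \<sigma> M" .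
        obtain s where s: "emeasure \<sigma> M = ennreal s" "0 \<le> s" using fin[OF MQ] by (cases "emeasure \<sigma> M") auto
        have l2: "l i / 2 = ennreal (2 powi i / 2)" unfolding l_def
          by (simp add: divide_ennreal[symmetric])
        show ?thesis
        proof (cases "\<integral>\<^sup>+x\<in>M. h i x \<partial>\<sigma>")
          case top
          moreover have "2 / l i \<noteq> 0" using l(2)[of i] by (simp add: ennreal_divide_eq_0_iff)
          ultimately show ?thesis by (simp add: dens ennreal_mult_top)
        next
          case (real H)
          have "2 powi i * s \<le> H + (2 powi i / 2) * s"
            using * unfolding real s l2 using s(2) real(1)
            by (simp add: l_def ennreal_mult[symmetric] ennreal_plus[symmetric] del: ennreal_plus)
          then have "s \<le> 2 / 2 powi i * H" by (simp add: field_simps)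
          then have "ennreal s \<le> ennreal (2 / 2 powi i) * ennreal H"
            using real(1) by (simp add: ennreal_mult[symmetric])
          then show ?thesis unfolding dens real s l_def by (simp add: divide_ennreal[symmetric])
        qed
      qed
      finally show "(\<integral>\<^sup>+Q. \<tau> Q \<partial>count_space {Q \<in> \<S>. Q \<subseteq> M}) \<le> c * (2 / l i) * emeasure (density \<sigma> (h i)) M"
        by (simp add: mult_left_mono mult.assoc)
    qed
    also have "emeasure (density \<sigma> (h i)) (\<Union>\<S>) \<le> emeasure (density \<sigma> (h i)) (space \<sigma>)"
      by (metis emeasure_space space_density)
    also have "\<dots> = (\<integral>\<^sup>+x. h i x \<partial>\<sigma>)"
      by (subst emeasure_density) (auto intro!: nn_integral_cong)
    finally show ?thesis by (simp add: mult_left_mono)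
  qed
  have tail: "(\<integral>\<^sup>+i. (\<integral>\<^sup>+x. l i * h i x \<partial>\<sigma>) \<partial>count_space UNIV) \<le> 4 * (\<integral>\<^sup>+x. (f x)\<^sup>2 \<partial>\<sigma>)"
  proof -
    have "(\<integral>\<^sup>+i. (\<integral>\<^sup>+x. l i * h i x \<partial>\<sigma>) \<partial>count_space UNIV)
        = (\<integral>\<^sup>+x. (\<integral>\<^sup>+i. l i * h i x \<partial>count_space UNIV) \<partial>\<sigma>)"
      by (rule nn_integral_count_space_nn_integral[symmetric]) auto
    also have "\<dots> \<le> (\<integral>\<^sup>+x. 4 * (f x)\<^sup>2 \<partial>\<sigma>)"
    proof (rule nn_integral_mono)
      fix x
      have "(\<integral>\<^sup>+i. l i * h i x \<partial>count_space UNIV)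
          = (\<integral>\<^sup>+i. f x * (l i * indicator {i. l i < 2 * f x} i) \<partial>count_space UNIV)"
        by (rule nn_integral_cong) (auto simp: h_def indicator_def mult_ac)
      also have "\<dots> = f x * (\<integral>\<^sup>+i. l i * indicator {i. l i < 2 * f x} i \<partial>count_space UNIV)"
        by (rule nn_integral_cmult) auto
      also have "\<dots> \<le> f x * (4 * f x)"
        unfolding l_def by (intro mult_left_mono dyadic_sum_below_le) auto
      finally show "(\<integral>\<^sup>+i. l i * h i x \<partial>count_space UNIV) \<le> 4 * (f x)\<^sup>2"
        by (simp add: power2_eq_square mult_ac)
    qed
    also have "\<dots> = 4 * (\<integral>\<^sup>+x. (f x)\<^sup>2 \<partial>\<sigma>)" by (rule nn_integral_cmult) auto
    finally show ?thesis .
  qed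
  have "(\<integral>\<^sup>+Q. \<tau> Q * (m Q)\<^sup>2 \<partial>count_space \<Q>)
     \<le> (\<integral>\<^sup>+Q. (\<integral>\<^sup>+i. 4 * (l i)\<^sup>2 * (\<tau> Q * indicator {Q. l i < m Q} Q) \<partial>count_space UNIV) \<partial>count_space \<Q>)"
  proof (rule nn_integral_mono)
    fix Q
    have "\<tau> Q * (m Q)\<^sup>2 \<le> \<tau> Q * (\<integral>\<^sup>+i. 4 * (l i)\<^sup>2 * indicator {i. l i < m Q} i \<partial>count_space UNIV)"
      unfolding l_def by (intro mult_left_mono square_le_dyadic_sum) auto
    also have "\<dots> = (\<integral>\<^sup>+i. \<tau> Q * (4 * (l i)\<^sup>2 * indicator {i. l i < m Q} i) \<partial>count_space UNIV)"
      by (rule nn_integral_cmult[symmetric]) auto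
    also have "\<dots> = (\<integral>\<^sup>+i. 4 * (l i)\<^sup>2 * (\<tau> Q * indicator {Q. l i < m Q} Q) \<partial>count_space UNIV)"
      by (rule nn_integral_cong) (auto simp: indicator_def mult_ac)
    finally show "\<tau> Q * (m Q)\<^sup>2 \<le> \<dots>" .
  qed
  also have "\<dots> = (\<integral>\<^sup>+i. (\<integral>\<^sup>+Q. 4 * (l i)\<^sup>2 * (\<tau> Q * indicator {Q. l i < m Q} Q) \<partial>count_space \<Q>) \<partial>count_space UNIV)"
    by (rule nn_integral_count_space_nn_integral) (auto simp: cQ)
  also have "\<dots> = (\<integral>\<^sup>+i. 4 * (l i)\<^sup>2 * (\<integral>\<^sup>+Q. \<tau> Q * indicator {Q. l i < m Q} Q \<partial>count_space \<Q>) \<partial>count_space UNIV)"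
    by (intro nn_integral_cong nn_integral_cmult) auto
  also have "\<dots> \<le> (\<integral>\<^sup>+i. 8 * c * (\<integral>\<^sup>+x. l i * h i x \<partial>\<sigma>) \<partial>count_space UNIV)"
  proof (rule nn_integral_mono)
    fix i
    have "4 * (l i)\<^sup>2 * (\<integral>\<^sup>+Q. \<tau> Q * indicator {Q. l i < m Q} Q \<partial>count_space \<Q>)
       \<le> 4 * (l i)\<^sup>2 * (c * (2 / l i) * (\<integral>\<^sup>+x. h i x \<partial>\<sigma>))"
      by (intro mult_left_mono level) auto
    also have "\<dots> = 4 * ((l i)\<^sup>2 * (2 / l i)) * (c * (\<integral>\<^sup>+x. h i x \<partial>\<sigma>))"
      by (simp add: mult_ac)
    also have "(l i)\<^sup>2 * (2 / l i) = 2 * l i"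
    proof -
      have "2 / l i = ennreal (2 / 2 powi i)"
        unfolding l_def using divide_ennreal[of 2 "2 powi i"] by simp
      moreover have "(l i)\<^sup>2 = ennreal ((2 powi i)\<^sup>2)"
        unfolding l_def by (rule ennreal_power) simp
      ultimately have "(l i)\<^sup>2 * (2 / l i) = ennreal ((2 powi i)\<^sup>2 * (2 / 2 powi i))"
        using ennreal_mult[of "(2 powi i)\<^sup>2" "2 / 2 powi i"] by simp
      also have "(2 powi i)\<^sup>2 * (2 / 2 powi i) = (2 * 2 powi i :: real)"
        by (simp add: power2_eq_square)
      finally show ?thesis by (simp add: l_def ennreal_mult)
    qed
    also have "4 * (2 * l i) * (c * (\<integral>\<^sup>+x. h i x \<partial>\<sigma>)) = 8 * c * (l i * (\<integral>\<^sup>+x. h i x \<partial>\<sigma>))"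
      by (simp add: mult_ac)
    also have "l i * (\<integral>\<^sup>+x. h i x \<partial>\<sigma>) = (\<integral>\<^sup>+x. l i * h i x \<partial>\<sigma>)"
      by (rule nn_integral_cmult[symmetric]) auto
    finally show "4 * (l i)\<^sup>2 * (\<integral>\<^sup>+Q. \<tau> Q * indicator {Q. l i < m Q} Q \<partial>count_space \<Q>) \<le> 8 * c * (\<integral>\<^sup>+x. l i * h i x \<partial>\<sigma>)" .
  qed
  also have "\<dots> = 8 * c * (\<integral>\<^sup>+i. (\<integral>\<^sup>+x. l i * h i x \<partial>\<sigma>) \<partial>count_space UNIV)"
    by (rule nn_integral_cmult) auto
  also have "8 * c * (\<integral>\<^sup>+i. (\<integral>\<^sup>+x. l i * h i x \<partial>\<sigma>) \<partial>count_space UNIV)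
      \<le> 8 * c * (4 * (\<integral>\<^sup>+x. (f x)\<^sup>2 \<partial>\<sigma>))"
    by (intro mult_left_mono tail) auto
  finally show ?thesis by (simp add: m_def mult_ac)
qed

section \<open>Closed and half-open cubes\<close>

lemma emeasure_compact_finite:
  assumes "locally_finite_borel \<mu>" "compact K"
  shows "emeasure \<mu> K < \<infinity>"
proof -
  have s[measurable_cong]: "sets \<mu> = sets borel" using assms by (simp add: locally_finite_borel_def)
  obtain U where U: "\<And>x. open (U x) \<and> x \<in> U x \<and> emeasure \<mu> (U x) < \<infinity>"
    using assms(1) unfolding locally_finite_borel_def by metis
  obtain T where T: "T \<subseteq> K" "finite T" "K \<subseteq> (\<Union>x\<in>T. U x)"
    using compactE_image[OF assms(2), of K U] U by blast
  have "emeasure \<mu> K \<le> emeasure \<mu> (\<Union>x\<in>T. U x)"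
    using T U s by (intro emeasure_mono) (auto intro!: sets.finite_UN)
  also have "\<dots> \<le> (\<Sum>x\<in>T. emeasure \<mu> (U x))"
    using U s T by (intro emeasure_subadditive_finite) auto
  also have "\<dots> < \<infinity>" using U T by (simp add: less_top[symmetric])
  finally show ?thesis .
qed

lemma mem_cube: "x \<in> cube c l \<longleftrightarrow> (\<forall>i. c $ i - l / 2 \<le> x $ i \<and> x $ i \<le> c $ i + l / 2)"
  by (auto simp: cube_def mem_box_cart)

lemma cube_borel [measurable]: "cube c l \<in> sets borel"
  by (simp add: cube_def)

lemma emeasure_cube_finite:
  "locally_finite_borel \<mu> \<Longrightarrow> emeasure \<mu> (cube c l) < \<infinity>"
  by (rule emeasure_compact_finite) (simp_all add: cube_def)

lemma emeasure_lborel_cube: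
  fixes c :: "real ^ 'n"
  assumes "0 \<le> l"
  shows "emeasure lborel (cube c l) = ennreal (l ^ CARD('n))"
proof -
  have ne: "cube c l \<noteq> {}" using assms mem_cube[of c c l] by auto
  have "measure lborel (cube c l) = l ^ CARD('n)"
    using ne unfolding cube_def by (subst content_cbox_cart) auto
  moreover have "emeasure lborel (cube c l) \<noteq> \<infinity>"
    unfolding cube_def using emeasure_lborel_cbox_finite by (metis less_irrefl infinity_ennreal_def)
  ultimately show ?thesis by (simp add: emeasure_eq_ennreal_measure)
qed

lemma cube_mono: "l \<le> l' \<Longrightarrow> cube c l \<subseteq> cube c l'"
  unfolding subset_iff mem_cube by (smt (verit, best) divide_right_mono)

lemma cube_pow2 [simp]: "cube c (2 powi k) \<in> pow2_cubes"
  by (auto simp: pow2_cubes_def)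

lemma pow2_cubesE:
  assumes "Q \<in> pow2_cubes"
  obtains c k where "Q = cube c (2 powi k)"
  using assms by (auto simp: pow2_cubes_def)

text \<open>The cells of a dyadic grid must be disjoint, so they are half open, whereas the maximal function
  and the testing condition use closed cubes.\<close>

definition hcube :: "real ^ 'n \<Rightarrow> real \<Rightarrow> (real ^ 'n) set" where
  "hcube c l = {x. \<forall>i. c $ i - l / 2 \<le> x $ i \<and> x $ i < c $ i + l / 2}"

lemma hcube_borel [measurable]: "hcube c l \<in> sets borel"
  unfolding hcube_def by measurable

lemma hcube_subset_cube: "hcube c l \<subseteq> cube c l"
  unfolding subset_iff mem_cube hcube_def by (auto intro: less_imp_le)

lemma emeasure_lborel_hcube:
  fixes c :: "real ^ 'n"
  assumes "0 \<le> l"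
  shows "emeasure lborel (hcube c l) = ennreal (l ^ CARD('n))"
proof (rule antisym)
  let ?a = "c - (\<chi> i. l / 2)" and ?b = "c + (\<chi> i. l / 2)"
  show "emeasure lborel (hcube c l) \<le> ennreal (l ^ CARD('n))"
    unfolding emeasure_lborel_cube[OF assms, of c, symmetric]
    by (intro emeasure_mono hcube_subset_cube) simp
  have "emeasure lborel (cube c l) = emeasure lborel (box ?a ?b)"
    unfolding cube_def by (simp add: emeasure_lborel_cbox_eq emeasure_lborel_box_eq)
  also have "\<dots> \<le> emeasure lborel (hcube c l)"
    by (intro emeasure_mono) (auto simp: hcube_def mem_box_cart less_imp_le)
  finally show "ennreal (l ^ CARD('n)) \<le> emeasure lborel (hcube c l)"
    by (simp add: emeasure_lborel_cube[OF assms])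
qed

lemma hcube_subsetD:
  assumes "hcube c l \<subseteq> hcube c' l'" "0 < l"
  shows "c' $ i - l' / 2 \<le> c $ i - l / 2" "c $ i + l / 2 \<le> c' $ i + l' / 2"
proof -
  have low: "(\<chi> j. c $ j - l / 2) \<in> hcube c l" using assms(2) by (simp add: hcube_def)
  then have "(\<chi> j. c $ j - l / 2) \<in> hcube c' l'" using assms(1) by blast
  then show "c' $ i - l' / 2 \<le> c $ i - l / 2" by (simp add: hcube_def)
  show "c $ i + l / 2 \<le> c' $ i + l' / 2"
  proof (rule ccontr)
    assume *: "\<not> ?thesis"
    \<comment> \<open>A point of the smaller cube that reaches the upper face of the larger one in direction \<open>i\<close>.\<close>
    define p where "p = (\<chi> j. max (c $ j - l / 2) (if j = i then c' $ j + l' / 2 else c $ j - l / 2))"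
    have "p \<in> hcube c l" using assms(2) * by (auto simp: p_def hcube_def)
    then have "p $ i < c' $ i + l' / 2" using assms(1) by (auto simp: hcube_def)
    then show False by (simp add: p_def)
  qed
qed

lemma hcube_inject:
  assumes "hcube c l = hcube c' l'" "0 < l" "0 < l'"
  shows "c = c'" "l = l'"
proof -
  have *: "c $ i - l / 2 = c' $ i - l' / 2 \<and> c $ i + l / 2 = c' $ i + l' / 2" for i
    using hcube_subsetD[of c l c' l' i] hcube_subsetD[of c' l' c l i] assms by auto
  show "c = c'" unfolding vec_eq_iff
  proof
    fix i show "c $ i = c' $ i" using *[of i] by linarith
  qed
  show "l = l'" using *[of undefined] by linarith
qed

text \<open>The closed dilate of a half-open cube, as a function of the set; the choice is harmless because a
  half-open cube determines its centre and side length.\<close>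

definition dilate :: "real \<Rightarrow> (real ^ 'n) set \<Rightarrow> (real ^ 'n) set" where
  "dilate t Q = (SOME K. \<exists>c l. 0 < l \<and> Q = hcube c l \<and> K = cube c (t * l))"

lemma dilate_hcube:
  assumes "0 < l"
  shows "dilate t (hcube c l) = cube c (t * l)"
proof -
  have "\<exists>c' l'. 0 < l' \<and> hcube c l = hcube c' l' \<and> dilate t (hcube c l) = cube c' (t * l')"
    unfolding dilate_def by (rule someI_ex) (use assms in blast)
  then show ?thesis using hcube_inject assms by metis
qed

text \<open>Concentric dilation by a common factor preserves inclusion: the difference of the centres is at
  most half the difference of the side lengths, and the latter is multiplied by the factor.\<close>

lemma dilate_mono:
  assumes "hcube c l \<subseteq> hcube c' l'" "0 < l" "0 < l'" "1 \<le> t"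
  shows "dilate t (hcube c l) \<subseteq> dilate t (hcube c' l')"
  unfolding dilate_hcube[OF assms(2)] dilate_hcube[OF assms(3)]
proof (intro subsetI)
  fix x assume x: "x \<in> cube c (t * l)"
  have "c' $ i - t * l' / 2 \<le> x $ i \<and> x $ i \<le> c' $ i + t * l' / 2" for i
  proof -
    note s = hcube_subsetD[OF assms(1,2), of i]
    have "l \<le> l'" using s by linarith
    then have "(t - 1) * (l' - l) \<ge> 0" using assms(4) by simp
    then have "t * l' - t * l \<ge> l' - l" by (simp add: algebra_simps)
    moreover have "c $ i - t * l / 2 \<le> x $ i" "x $ i \<le> c $ i + t * l / 2"
      using x by (auto simp: mem_cube)
    ultimately show ?thesis using s by linarith
  qed
  then show "x \<in> cube c' (t * l')" by (simp add: mem_cube)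
qed

section \<open>Maximal functions of indicators and the testing integral\<close>

text \<open>The sets on which \<open>f\<close> fails to be integrable cause no trouble: there the Bochner integral is zero.\<close>

lemma total_variation_weighted_le:
  assumes [measurable_cong]: "sets \<sigma> = sets borel" and [measurable]: "f \<in> borel_measurable \<sigma>"
  shows "total_variation (weighted f \<sigma>) E \<le> (\<integral>\<^sup>+x\<in>E. ennreal \<bar>f x\<bar> \<partial>\<sigma>)"
  unfolding total_variation_def
proof (rule SUP_least)
  fix P assume P: "P \<in> {P. finite P \<and> P \<subseteq> sets borel \<and> disjoint P \<and> \<Union>P = E}"
  define \<nu> where "\<nu> = density \<sigma> (\<lambda>x. ennreal \<bar>f x\<bar>)"
  have \<nu>: "emeasure \<nu> A = (\<integral>\<^sup>+x\<in>A. ennreal \<bar>f x\<bar> \<partial>\<sigma>)" if "A \<in> sets borel" for A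
    unfolding \<nu>_def using that assms by (intro emeasure_density) auto
  have s: "sets \<nu> = sets borel" by (simp add: \<nu>_def assms)
  have "(\<Sum>A\<in>P. ennreal \<bar>weighted f \<sigma> A\<bar>) \<le> (\<Sum>A\<in>P. emeasure \<nu> A)"
  proof (rule sum_mono)
    fix A assume "A \<in> P"
    then have A[measurable]: "A \<in> sets borel" using P by auto
    have "ennreal \<bar>weighted f \<sigma> A\<bar> \<le> (\<integral>\<^sup>+x. ennreal (norm (indicator A x *\<^sub>R f x)) \<partial>\<sigma>)"
    proof (cases "integrable \<sigma> (\<lambda>x. indicator A x *\<^sub>R f x)")
      case True
      then show ?thesis unfolding weighted_def set_lebesgue_integral_def
        using integral_norm_bound_ennreal by fastforce
    next
      case False
      then show ?thesis unfolding weighted_def set_lebesgue_integral_def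
        by (simp add: not_integrable_integral_eq)
    qed
    also have "\<dots> = emeasure \<nu> A" unfolding \<nu>[OF A]
      by (rule nn_integral_cong) (auto simp: indicator_def)
    finally show "ennreal \<bar>weighted f \<sigma> A\<bar> \<le> emeasure \<nu> A" .
  qed
  also have "\<dots> = emeasure \<nu> (\<Union>A\<in>P. A)"
  proof (rule sum_emeasure)
    show "disjoint_family_on (\<lambda>A. A) P"
      using P by (auto simp: disjoint_family_on_def disjoint_def)
  qed (use P s in auto)
  also have "\<dots> = (\<integral>\<^sup>+x\<in>E. ennreal \<bar>f x\<bar> \<partial>\<sigma>)"
  proof -
    have "E \<in> sets borel" using P by (auto intro: sets.finite_Union)
    then show ?thesis using \<nu> P by simp
  qed
  finally show "(\<Sum>A\<in>P. ennreal \<bar>weighted f \<sigma> A\<bar>) \<le> (\<integral>\<^sup>+x\<in>E. ennreal \<bar>f x\<bar> \<partial>\<sigma>)" .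
qed

lemma maximal_function_indicator_ge:
  assumes lf: "locally_finite_borel \<sigma>" and L: "L \<in> pow2_cubes" "x \<in> L" "L \<subseteq> K"
    and K: "K \<in> sets borel"
  shows "emeasure \<sigma> L / emeasure lborel L \<le> maximal_function (weighted (indicator K) \<sigma>) x"
proof -
  have s: "sets \<sigma> = sets borel" using lf by (simp add: locally_finite_borel_def)
  obtain c k where Lc: "L = cube c (2 powi k)" using L(1) by (rule pow2_cubesE)
  have Ls: "L \<in> sets borel" unfolding Lc by simp
  have fin: "emeasure \<sigma> L < \<infinity>" unfolding Lc by (rule emeasure_cube_finite[OF lf])
  have "weighted (indicator K) \<sigma> L = measure \<sigma> L"
  proof -
    have "weighted (indicator K) \<sigma> L = (LINT x|\<sigma>. indicator L x)"
      unfolding weighted_def set_lebesgue_integral_def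
      by (rule Bochner_Integration.integral_cong) (use L(3) in \<open>auto simp: indicator_def\<close>)
    also have "\<dots> = measure \<sigma> L"
      using Ls s by (simp add: sets_eq_imp_space_eq[OF s])
    finally show ?thesis .
  qed
  then have "ennreal \<bar>weighted (indicator K) \<sigma> L\<bar> = emeasure \<sigma> L"
    using fin by (simp add: emeasure_eq_ennreal_measure less_top[symmetric])
  moreover have "ennreal \<bar>weighted (indicator K) \<sigma> L\<bar> \<le> total_variation (weighted (indicator K) \<sigma>) L"
    unfolding total_variation_def
    by (rule SUP_upper2[of "{L}"]) (use Ls in \<open>auto simp: disjoint_def\<close>)
  ultimately have "emeasure \<sigma> L / emeasure lborel L
      \<le> total_variation (weighted (indicator K) \<sigma>) L / emeasure lborel L"
    by (simp add: divide_right_mono_ennreal)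
  also have "\<dots> \<le> maximal_function (weighted (indicator K) \<sigma>) x"
    unfolding maximal_function_def by (rule SUP_upper) (use L in auto)
  finally show ?thesis .
qed

lemma nn_integral_count_space_disjoint:
  assumes "disjoint_family_on E \<S>" "Q \<in> \<S>" "x \<in> E Q"
  shows "(\<integral>\<^sup>+R. v R * indicator (E R) x \<partial>count_space \<S>) = v Q"
proof -
  have "(\<integral>\<^sup>+R. v R * indicator (E R) x \<partial>count_space \<S>) = (\<Sum>R\<in>{Q}. v R * indicator (E R) x)"
    by (rule nn_integral_count_space')
      (use assms in \<open>auto simp: disjoint_family_on_def indicator_def\<close>)
  then show ?thesis using assms(3) by simp
qed

text \<open>Sums over disjoint pieces are integrals of a function which at each point has at most one nonzero
  summand. This makes pointwise comparison with a maximal function possible.\<close>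

lemma nn_integral_disjoint_pieces:
  fixes v :: "'b \<Rightarrow> ennreal"
  assumes "countable \<S>" "\<And>Q. Q \<in> \<S> \<Longrightarrow> E Q \<in> sets \<omega>"
  shows "(\<integral>\<^sup>+Q. emeasure \<omega> (E Q) * v Q \<partial>count_space \<S>)
      = (\<integral>\<^sup>+x. (\<integral>\<^sup>+Q. v Q * indicator (E Q) x \<partial>count_space \<S>) \<partial>\<omega>)"
proof -
  have "(\<integral>\<^sup>+Q. emeasure \<omega> (E Q) * v Q \<partial>count_space \<S>)
      = (\<integral>\<^sup>+Q. (\<integral>\<^sup>+x. v Q * indicator (E Q) x \<partial>\<omega>) \<partial>count_space \<S>)"
    by (rule nn_integral_cong) (use assms(2) in \<open>simp add: nn_integral_cmult_indicator mult.commute\<close>)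
  also have "\<dots> = (\<integral>\<^sup>+x. (\<integral>\<^sup>+Q. v Q * indicator (E Q) x \<partial>count_space \<S>) \<partial>\<omega>)"
    by (rule nn_integral_count_space_nn_integral[symmetric]) (use assms in auto)
  finally show ?thesis .
qed

text \<open>At a point of \<open>E Q\<close> the cube \<open>L Q\<close> is a competitor in the supremum that defines the maximal
  function of \<open>1\<^sub>K \<sigma>\<close>, and since the pieces are disjoint these pointwise bounds can be added.\<close>

lemma sum_le_testing_integral:
  fixes \<sigma> \<omega> :: "(real ^ 'n) measure"
  assumes lf: "locally_finite_borel \<sigma>" "locally_finite_borel \<omega>"
    and S: "countable \<S>" and E: "\<And>Q. Q \<in> \<S> \<Longrightarrow> E Q \<in> sets borel" "disjoint_family_on E \<S>"
    and L: "\<And>Q. Q \<in> \<S> \<Longrightarrow> E Q \<subseteq> L Q \<and> L Q \<in> pow2_cubes \<and> L Q \<subseteq> K"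
    and K: "K \<in> sets borel"
  shows "(\<integral>\<^sup>+Q. emeasure \<omega> (E Q) * (emeasure \<sigma> (L Q) / emeasure lborel (L Q))\<^sup>2 \<partial>count_space \<S>)
      \<le> (\<integral>\<^sup>+x\<in>K. (maximal_function (weighted (indicator K) \<sigma>) x)\<^sup>2 \<partial>\<omega>)"
proof -
  have s: "sets \<omega> = sets borel" using lf by (simp add: locally_finite_borel_def)
  let ?v = "\<lambda>Q. (emeasure \<sigma> (L Q) / emeasure lborel (L Q))\<^sup>2"
  have "(\<integral>\<^sup>+Q. emeasure \<omega> (E Q) * ?v Q \<partial>count_space \<S>)
      = (\<integral>\<^sup>+x. (\<integral>\<^sup>+Q. ?v Q * indicator (E Q) x \<partial>count_space \<S>) \<partial>\<omega>)"
    by (rule nn_integral_disjoint_pieces) (use S E s in auto)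
  also have "\<dots> \<le> (\<integral>\<^sup>+x\<in>K. (maximal_function (weighted (indicator K) \<sigma>) x)\<^sup>2 \<partial>\<omega>)"
  proof (rule nn_integral_mono)
    fix x
    show "(\<integral>\<^sup>+Q. ?v Q * indicator (E Q) x \<partial>count_space \<S>)
      \<le> (maximal_function (weighted (indicator K) \<sigma>) x)\<^sup>2 * indicator K x"
    proof (cases "\<exists>Q\<in>\<S>. x \<in> E Q")
      case True
      then obtain Q where Q: "Q \<in> \<S>" "x \<in> E Q" by blast
      then have x: "x \<in> L Q" "x \<in> K" using L by blast+
      have "(\<integral>\<^sup>+Q. ?v Q * indicator (E Q) x \<partial>count_space \<S>) = ?v Q"
        using E(2) Q by (rule nn_integral_count_space_disjoint)
      also have "\<dots> \<le> (maximal_function (weighted (indicator K) \<sigma>) x)\<^sup>2"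
        by (intro power_mono maximal_function_indicator_ge[OF lf(1)]) (use L Q x K in auto)
      finally show ?thesis using x by simp
    next
      case False
      then have "(\<integral>\<^sup>+Q. ?v Q * indicator (E Q) x \<partial>count_space \<S>) = (\<integral>\<^sup>+Q. 0 \<partial>count_space \<S>)"
        by (intro nn_integral_cong) (auto simp: indicator_def)
      then show ?thesis by simp
    qed
  qed
  finally show ?thesis .
qed

section \<open>Packing from dilated testing\<close>

lemma A2_const_real:
  assumes lf: "locally_finite_borel \<sigma>" "locally_finite_borel \<omega>"
    and A2: "A2_const \<sigma> \<omega> = ennreal A" and "0 \<le> A"
  shows "measure \<sigma> (cube c (2 powi k)) * measure \<omega> (cube c (2 powi k))
           \<le> A * (measure lborel (cube c (2 powi k)))\<^sup>2"
proof -
  let ?K = "cube c (2 powi k)"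
  have fin: "emeasure \<sigma> ?K = ennreal (measure \<sigma> ?K)" "emeasure \<omega> ?K = ennreal (measure \<omega> ?K)"
    using emeasure_cube_finite[OF lf(1)] emeasure_cube_finite[OF lf(2)]
    by (simp_all add: emeasure_eq_ennreal_measure less_top[symmetric])
  define v where "v = measure lborel ?K"
  have v: "emeasure lborel ?K = ennreal v" "v > 0"
    unfolding v_def using emeasure_lborel_cube[of "2 powi k" c] by (auto simp: measure_def)
  have "(emeasure \<sigma> ?K / emeasure lborel ?K) * (emeasure \<omega> ?K / emeasure lborel ?K) \<le> ennreal A"
    unfolding A2[symmetric] A2_const_def by (rule SUP_upper) simp
  then have "measure \<sigma> ?K / v * (measure \<omega> ?K / v) \<le> A"
    unfolding fin v(1) using v(2) assms(4) by (simp add: divide_ennreal ennreal_mult[symmetric])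
  then have "measure \<sigma> ?K * measure \<omega> ?K / v\<^sup>2 \<le> A"
    by (simp add: power2_eq_square)
  moreover have "0 < v\<^sup>2" using v(2) by simp
  ultimately show ?thesis
    unfolding v_def[symmetric] by (meson pos_divide_le_eq[THEN iffD1])
qed

text \<open>If no dilate were doubling, then \<open>\<sigma>(G\<^sup>j Q) \<omega>(G\<^sup>j Q) \<ge> D\<^sup>j \<sigma>(Q) \<omega>(Q)\<close>, while the Muckenhoupt
  condition allows only \<open>A\<^sub>2 G\<^sup>2\<^sup>n\<^sup>j |Q|\<^sup>2\<close>. The factor \<open>2\<close> in \<open>D\<close> makes this impossible for large \<open>j\<close>.\<close>

lemma ex_doubling_dilate:
  fixes c :: "real ^ 'n"
  assumes lf: "locally_finite_borel \<sigma>" "locally_finite_borel \<omega>"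
    and A2: "A2_const \<sigma> \<omega> \<noteq> \<infinity>"
    and pos: "0 < measure \<sigma> (cube c (2 powi k))" "0 < measure \<omega> (cube c (2 powi k))"
    and D: "D = 2 * ((2 ^ g) ^ CARD('n))\<^sup>2"
  shows "\<exists>j. measure \<sigma> (cube c ((2 ^ g) ^ Suc j * 2 powi k)) \<le> D * measure \<sigma> (cube c ((2 ^ g) ^ j * 2 powi k))"
proof (rule ccontr)
  define s where "s j = measure \<sigma> (cube c ((2 ^ g) ^ j * 2 powi k))" for j
  define w where "w j = measure \<omega> (cube c ((2 ^ g) ^ j * 2 powi k))" for j
  define N where "N = CARD('n)"
  define h :: real where "h = ((2 ^ g) ^ N)\<^sup>2"
  assume "\<not> ?thesis"
  then have up: "D * s j \<le> s (Suc j)" for j unfolding s_def using linear by blast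
  have h: "h > 0" by (simp add: h_def)
  have Dh: "D = 2 * h" by (simp add: D h_def N_def)
  have s: "D ^ j * s 0 \<le> s j" for j
  proof (induction j)
    case (Suc j)
    have "D * (D ^ j * s 0) \<le> D * s j" using Suc h Dh by (intro mult_left_mono) auto
    then show ?case using up[of j] by (simp add: mult_ac)
  qed simp
  obtain A where A: "A2_const \<sigma> \<omega> = ennreal A" "0 \<le> A" using A2 by (cases "A2_const \<sigma> \<omega>") auto
  have w: "w 0 \<le> w j" for j
    unfolding w_def
  proof (rule measure_mono_fmeasurable)
    show "cube c ((2 ^ g) ^ 0 * 2 powi k) \<subseteq> cube c ((2 ^ g) ^ j * 2 powi k)"
      by (rule cube_mono) simp
  qed (use lf emeasure_cube_finite[OF lf(2)] in \<open>auto simp: fmeasurable_def locally_finite_borel_def\<close>)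
  define V where "V = ((2 powi k) ^ N :: real)\<^sup>2"
  have bd: "2 ^ j * (s 0 * w 0) \<le> A * V" for j
  proof -
    have pw: "(2 ^ g) ^ j * 2 powi k = (2 powi (int (g * j) + k) :: real)"
    proof -
      have "(2 powi (int (g * j) + k) :: real) = 2 powi int (g * j) * 2 powi k"
        by (rule power_int_add) simp
      also have "(2 powi int (g * j) :: real) = (2 ^ g) ^ j"
        by (simp only: power_int_of_nat power_mult)
      finally show ?thesis by simp
    qed
    have "s j * w j \<le> A * (measure lborel (cube c ((2 ^ g) ^ j * 2 powi k)))\<^sup>2"
      unfolding s_def w_def pw by (rule A2_const_real[OF lf A])
    also have "measure lborel (cube c ((2 ^ g) ^ j * 2 powi k)) = ((2 ^ g) ^ j * 2 powi k) ^ N"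
      by (simp add: measure_def emeasure_lborel_cube N_def)
    also have "(((2 ^ g) ^ j * 2 powi k) ^ N)\<^sup>2 = h ^ j * V"
      by (simp add: h_def V_def power_mult_distrib power_mult[symmetric] mult_ac)
    finally have sw: "s j * w j \<le> A * (h ^ j * V)" .
    have "(D ^ j * s 0) * w 0 \<le> s j * w j"
      using s w by (intro mult_mono) (auto simp: s_def w_def)
    then have "h ^ j * (2 ^ j * (s 0 * w 0)) \<le> h ^ j * (A * V)"
      using sw by (simp add: Dh power_mult_distrib mult_ac)
    then show ?thesis using h by (simp add: mult_le_cancel_left_pos)
  qed
  have sw: "s 0 * w 0 > 0" using pos by (simp add: s_def w_def)
  obtain j where j: "A * V / (s 0 * w 0) < 2 ^ j" using real_arch_pow[of 2] by auto
  have "A * V < 2 ^ j * (s 0 * w 0)" using iffD1[OF pos_divide_less_eq[OF sw] j] .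
  then show False using bd[of j] by linarith
qed

lemma dilate_hcube_pow2:
  "dilate ((2 ^ g) ^ j) (hcube c (2 powi k)) = cube c (2 powi (int (g * j) + k))"
proof -
  have "(2 powi (int (g * j) + k) :: real) = 2 powi int (g * j) * 2 powi k"
    by (rule power_int_add) simp
  also have "(2 powi int (g * j) :: real) = (2 ^ g) ^ j"
    by (simp only: power_int_of_nat power_mult)
  finally show ?thesis by (simp add: dilate_hcube)
qed

lemma ex_power_sandwich:
  fixes y :: real
  assumes "1 \<le> y"
  shows "\<exists>r. 2 ^ r \<le> y \<and> y \<le> 2 ^ Suc r"
proof -
  obtain m where "y < 2 ^ m" using real_arch_pow[of 2 y] by auto
  then have "y \<le> 2 ^ Suc m" using assms by simp
  then have ex: "\<exists>m. y \<le> 2 ^ Suc m" ..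
  define r where "r = (LEAST m. y \<le> 2 ^ Suc m)"
  have up: "y \<le> 2 ^ Suc r" unfolding r_def using ex by (rule LeastI_ex)
  have "2 ^ r \<le> y"
  proof (cases r)
    case (Suc m)
    then have "\<not> y \<le> 2 ^ Suc m" using not_less_Least[of m "\<lambda>m. y \<le> 2 ^ Suc m"] by (simp add: r_def)
    then show ?thesis using Suc by simp
  qed (use assms in simp)
  then show ?thesis using up by blast
qed

text \<open>\<open>Q\<close> lies in the class \<open>(j, r)\<close> if its dilate \<open>K\<close> by \<open>G\<^sup>j\<close> is doubling and \<open>\<sigma>(K) / \<sigma>(Q)\<close> is \<open>2\<^sup>r D\<^sup>j\<close>
  up to a factor of two. Factoring out \<open>D\<^sup>j\<close> makes \<open>r\<close> range over the natural numbers.\<close>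

definition doubling_class :: "(real ^ 'n) measure \<Rightarrow> real \<Rightarrow> real \<Rightarrow> nat \<Rightarrow> nat \<Rightarrow> (real ^ 'n) set \<Rightarrow> bool" where
  "doubling_class \<sigma> G D j r Q \<longleftrightarrow>
     measure \<sigma> (dilate (G ^ Suc j) Q) \<le> D * measure \<sigma> (dilate (G ^ j) Q) \<and>
     2 ^ r * (D ^ j * measure \<sigma> Q) \<le> measure \<sigma> (dilate (G ^ j) Q) \<and>
     measure \<sigma> (dilate (G ^ j) Q) \<le> 2 ^ Suc r * (D ^ j * measure \<sigma> Q)"

text \<open>Take \<open>j\<close> minimal: all smaller dilates fail to be doubling, which forces \<open>\<sigma>(G\<^sup>j Q) \<ge> D\<^sup>j \<sigma>(Q)\<close>.\<close>

lemma ex_doubling_class: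
  fixes c :: "real ^ 'n"
  assumes lf: "locally_finite_borel \<sigma>" "locally_finite_borel \<omega>"
    and A2: "A2_const \<sigma> \<omega> \<noteq> \<infinity>"
    and pos: "0 < measure \<sigma> (hcube c (2 powi k))" "0 < measure \<omega> (hcube c (2 powi k))"
    and D: "D = 2 * ((2 ^ g) ^ CARD('n))\<^sup>2"
  shows "\<exists>j r. doubling_class \<sigma> (2 ^ g) D j r (hcube c (2 powi k))"
proof -
  let ?Q = "hcube c (2 powi k)"
  define s where "s j = measure \<sigma> (dilate ((2 ^ g) ^ j) ?Q)" for j
  have mono: "measure \<mu> ?Q \<le> measure \<mu> (cube c (2 powi k))" if "locally_finite_borel \<mu>" for \<mu> :: "(real ^ 'n) measure"
  proof (rule measure_mono_fmeasurable[OF hcube_subset_cube])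
    have "sets \<mu> = sets borel" using that by (simp add: locally_finite_borel_def)
    then show "?Q \<in> sets \<mu>" "cube c (2 powi k) \<in> fmeasurable \<mu>"
      using emeasure_cube_finite[OF that] by (auto simp: fmeasurable_def)
  qed
  have D0: "D > 0" using D by simp
  have "\<exists>j. measure \<sigma> (cube c ((2 ^ g) ^ Suc j * 2 powi k)) \<le> D * measure \<sigma> (cube c ((2 ^ g) ^ j * 2 powi k))"
    using pos mono[OF lf(1)] mono[OF lf(2)] by (intro ex_doubling_dilate[OF lf A2 _ _ D]) auto
  then have ex: "\<exists>j. s (Suc j) \<le> D * s j" by (simp add: s_def dilate_hcube)
  define j where "j = (LEAST j. s (Suc j) \<le> D * s j)"
  have j: "s (Suc j) \<le> D * s j" unfolding j_def using ex by (rule LeastI_ex)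
  have "i \<le> j \<Longrightarrow> D ^ i * s 0 \<le> s i" for i
  proof (induction i)
    case (Suc i)
    then have "\<not> s (Suc i) \<le> D * s i" using not_less_Least[of i "\<lambda>j. s (Suc j) \<le> D * s j"] by (simp add: j_def)
    moreover have "D * (D ^ i * s 0) \<le> D * s i" using Suc D0 by (intro mult_left_mono) auto
    ultimately show ?case by (simp add: mult_ac)
  qed simp
  then have "D ^ j * s 0 \<le> s j" by simp
  moreover have "measure \<sigma> ?Q \<le> s 0" using mono[OF lf(1)] by (simp add: s_def dilate_hcube)
  ultimately have lower: "D ^ j * measure \<sigma> ?Q \<le> s j"
    using D0 by (meson mult_left_mono order_trans zero_le_power less_imp_le)
  have p: "D ^ j * measure \<sigma> ?Q > 0" using D0 pos by simp
  then have "1 \<le> s j / (D ^ j * measure \<sigma> ?Q)" using lower by simp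
  then obtain r where "2 ^ r \<le> s j / (D ^ j * measure \<sigma> ?Q)" "s j / (D ^ j * measure \<sigma> ?Q) \<le> 2 ^ Suc r"
    using ex_power_sandwich by blast
  then have "2 ^ r * (D ^ j * measure \<sigma> ?Q) \<le> s j" "s j \<le> 2 ^ Suc r * (D ^ j * measure \<sigma> ?Q)"
    using p pos_le_divide_eq pos_divide_le_eq by metis+
  then show ?thesis using j unfolding doubling_class_def s_def by blast
qed


text \<open>The heart of the proof. The enlarged cube on the right of the testing condition is harmless on a
  doubling cube \<open>K\<close>, but \<open>\<sigma>(K)\<close> may exceed \<open>\<sigma>(Q)\<close> by a factor \<open>1 / \<theta>\<close>. Within one class this loss is
  recovered, since replacing the averages over dilates by the averages over the cells themselves
  gains \<open>\<theta>\<^sup>2\<close>. What remains decays geometrically in \<open>j\<close> and \<open>r\<close>.\<close>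

theorem dilated_testing_imp_packing:
  fixes \<sigma> \<omega> :: "(real ^ 'n) measure"
  assumes lf: "locally_finite_borel \<sigma>" "locally_finite_borel \<omega>"
    and A2: "A2_const \<sigma> \<omega> \<noteq> \<infinity>"
    and testing: "\<And>(c :: real ^ 'n) k.
        (\<integral>\<^sup>+x\<in>cube c (2 powi k). (maximal_function (weighted (indicator (cube c (2 powi k))) \<sigma>) x)\<^sup>2 \<partial>\<omega>)
          \<le> ennreal (T\<^sup>2) * emeasure \<sigma> (cube c (\<Gamma> * 2 powi k))"
    and g: "\<Gamma> \<le> 2 ^ g"
    and lam: "laminar \<Q>" and hcubes: "\<And>Q. Q \<in> \<Q> \<Longrightarrow> \<exists>c k. Q = hcube c (2 powi k)"
    and E: "\<And>Q. Q \<in> \<Q> \<Longrightarrow> E Q \<in> sets borel \<and> E Q \<subseteq> Q" "disjoint_family_on E \<Q>"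
    and P: "P \<in> \<Q>"
  shows "(\<integral>\<^sup>+Q. emeasure \<omega> (E Q) * (emeasure \<sigma> Q / emeasure lborel Q)\<^sup>2 \<partial>count_space {Q \<in> \<Q>. Q \<subseteq> P})
      \<le> ennreal (16 * ((2 ^ g) ^ CARD('n))\<^sup>2 * T\<^sup>2) * emeasure \<sigma> P"
proof -
  define N where "N = CARD('n)"
  define h :: real where "h = ((2 ^ g) ^ N)\<^sup>2"
  \<comment> \<open>\<open>h\<close> is the square of the factor by which one dilation step changes volumes; \<open>D = 2h\<close> leaves a decay of \<open>1/2\<close> per step.\<close>
  define D where "D = 2 * h"
  define \<P> where "\<P> = {Q \<in> \<Q>. Q \<subseteq> P}"
  define cls where "cls j r Q \<longleftrightarrow> doubling_class \<sigma> (2 ^ g) D j r Q" for j r Q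
  define \<tau> where "\<tau> Q = emeasure \<omega> (E Q) * (emeasure \<sigma> Q / emeasure lborel Q)\<^sup>2" for Q
  define b :: "nat \<Rightarrow> nat \<Rightarrow> real" where "b j r = 2 * D * T\<^sup>2 * (1/2) ^ r * (1/2) ^ j" for j r
  have h: "h > 0" and D0: "D > 0" by (simp_all add: h_def D_def)
  have ss: "sets \<sigma> = sets borel" "sets \<omega> = sets borel" using lf by (auto simp: locally_finite_borel_def)
  have PQ: "\<P> \<subseteq> \<Q>" by (auto simp: \<P>_def)
  have lamP: "laminar \<P>" by (rule laminar_subset[OF lam PQ])
  have cP: "countable \<P>" by (rule laminarD(1)[OF lamP])
  have Qb: "Q \<in> sets borel" if "Q \<in> \<Q>" for Q using hcubes[OF that] hcube_borel by metis
  have finc: "emeasure \<sigma> (cube c l) = ennreal (measure \<sigma> (cube c l))" for c :: "real ^ 'n" and l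
    using emeasure_cube_finite[OF lf(1), of c l] by (simp add: emeasure_eq_ennreal_measure less_top[symmetric])
  have finh: "emeasure \<mu> Q = ennreal (measure \<mu> Q)"
    if \<mu>: "locally_finite_borel \<mu>" and QQ: "Q \<in> \<Q>" for Q and \<mu> :: "(real ^ 'n) measure"
  proof -
    obtain c k where Q: "Q = hcube c (2 powi k)" using hcubes[OF QQ] by blast
    have "sets \<mu> = sets borel" using \<mu> by (simp add: locally_finite_borel_def)
    then have "emeasure \<mu> Q \<le> emeasure \<mu> (cube c (2 powi k))"
      unfolding Q by (intro emeasure_mono hcube_subset_cube) auto
    also have "\<dots> < \<infinity>" by (rule emeasure_cube_finite[OF \<mu>])
    finally show ?thesis by (simp add: emeasure_eq_ennreal_measure less_top[symmetric])
  qed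
  have class_bound: "(\<integral>\<^sup>+Q. \<tau> Q * indicator {Q. cls j r Q} Q \<partial>count_space \<P>) \<le> ennreal (b j r) * emeasure \<sigma> P"
    for j r
  proof -
    define \<S> where "\<S> = {Q \<in> \<P>. cls j r Q}"
    define L where "L Q = dilate ((2 ^ g) ^ j) Q" for Q :: "(real ^ 'n) set"
    \<comment> \<open>The upper bound for \<open>\<theta>\<^sup>2\<close> in the class \<open>(j, r)\<close>, times the square of the volume ratio of \<open>L Q\<close> and \<open>Q\<close>.\<close>
    define a where "a = ((1/2) ^ r * (1 / D ^ j) * ((2 ^ g) ^ j) ^ N)\<^sup>2"
    have SP: "\<S> \<subseteq> \<P>" "\<S> \<subseteq> \<Q>" using PQ by (auto simp: \<S>_def)
    have a0: "a \<ge> 0" by (simp add: a_def)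
    have "(\<integral>\<^sup>+Q. \<tau> Q * indicator {Q. cls j r Q} Q \<partial>count_space \<P>) = (\<integral>\<^sup>+Q. \<tau> Q * indicator \<S> Q \<partial>count_space \<P>)"
      by (rule nn_integral_cong) (auto simp: \<S>_def indicator_def)
    also have "\<dots> = (\<integral>\<^sup>+Q. \<tau> Q \<partial>count_space \<S>)"
      using SP by (intro nn_integral_count_space_restrict) auto
    also have "\<dots> \<le> ennreal (b j r) * emeasure \<sigma> (\<Union>\<S>)"
    proof (rule laminar_sum_le_emeasure)
      show "laminar \<S>" by (rule laminar_subset[OF lam SP(2)])
      show "\<S> \<subseteq> sets \<sigma>" using SP Qb ss by auto
      fix M assume M: "M \<in> \<S>"
      then obtain c k where Mc: "M = hcube c (2 powi k)" using hcubes[of M] SP by blast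
      have Mcls: "doubling_class \<sigma> (2 ^ g) D j r M" using M by (simp add: \<S>_def cls_def)
      define \<R> where "\<R> = {Q \<in> \<S>. Q \<subseteq> M}"
      have cR: "countable \<R>" by (rule countable_subset[OF _ cP]) (use SP in \<open>auto simp: \<R>_def\<close>)
      have le_dilated: "\<tau> Q \<le> ennreal a * (emeasure \<omega> (E Q) * (emeasure \<sigma> (L Q) / emeasure lborel (L Q))\<^sup>2)"
        if QR: "Q \<in> \<R>" for Q
      proof -
        have QQ: "Q \<in> \<Q>" using QR SP by (auto simp: \<R>_def)
        obtain c' k' where Q: "Q = hcube c' (2 powi k')" using hcubes[OF QQ] by blast
        define V :: real where "V = (2 powi k') ^ N"
        define H :: real where "H = ((2 ^ g) ^ j) ^ N"
        define t where "t = measure \<sigma> Q"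
        define u where "u = measure \<sigma> (L Q)"
        have V: "V > 0" and H: "H > 0" by (simp_all add: V_def H_def)
        have LQ: "L Q = cube c' ((2 ^ g) ^ j * 2 powi k')" unfolding L_def Q by (rule dilate_hcube) simp
        have volL: "emeasure lborel (L Q) = ennreal (H * V)"
          unfolding LQ by (simp add: emeasure_lborel_cube H_def V_def N_def power_mult_distrib)
        have vol: "emeasure lborel Q = ennreal V"
          unfolding Q by (simp add: emeasure_lborel_hcube V_def N_def)
        have "2 ^ r * (D ^ j * t) \<le> u"
          using QR by (simp add: \<R>_def \<S>_def cls_def doubling_class_def t_def u_def L_def)
        then have "(1/2) ^ r * (1 / D ^ j) * (2 ^ r * (D ^ j * t)) \<le> (1/2) ^ r * (1 / D ^ j) * u"
          using D0 by (intro mult_left_mono) auto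
        moreover have "(1/2) ^ r * (1 / D ^ j) * (2 ^ r * (D ^ j * t)) = t"
          using D0 by (simp add: power_divide)
        ultimately have "t / V \<le> (1/2) ^ r * (1 / D ^ j) * u / V"
          using V by (intro divide_right_mono) auto
        also have "\<dots> = (1/2) ^ r * (1 / D ^ j) * H * (u / (H * V))" using H by simp
        finally have "(t / V)\<^sup>2 \<le> ((1/2) ^ r * (1 / D ^ j) * H * (u / (H * V)))\<^sup>2"
          using V by (intro power_mono) (auto simp: t_def)
        then have "(t / V)\<^sup>2 \<le> a * (u / (H * V))\<^sup>2" unfolding a_def H_def[symmetric] by (simp only: power_mult_distrib)
        then have "ennreal ((t / V)\<^sup>2) \<le> ennreal a * ennreal ((u / (H * V))\<^sup>2)"
          using a0 by (simp add: ennreal_mult[symmetric])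
        moreover have "(emeasure \<sigma> Q / emeasure lborel Q)\<^sup>2 = ennreal ((t / V)\<^sup>2)"
          unfolding vol finh[OF lf(1) QQ] t_def using V by (simp add: divide_ennreal ennreal_power)
        moreover have "(emeasure \<sigma> (L Q) / emeasure lborel (L Q))\<^sup>2 = ennreal ((u / (H * V))\<^sup>2)"
          unfolding volL u_def using V H finc[of c' "(2 ^ g) ^ j * 2 powi k'"]
          by (simp add: LQ divide_ennreal ennreal_power)
        ultimately have "(emeasure \<sigma> Q / emeasure lborel Q)\<^sup>2
            \<le> ennreal a * (emeasure \<sigma> (L Q) / emeasure lborel (L Q))\<^sup>2" by simp
        then have "\<tau> Q \<le> emeasure \<omega> (E Q) * (ennreal a * (emeasure \<sigma> (L Q) / emeasure lborel (L Q))\<^sup>2)"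
          unfolding \<tau>_def by (rule mult_left_mono) simp
        then show ?thesis by (simp add: mult_ac)
      qed
      have "(\<integral>\<^sup>+Q. \<tau> Q \<partial>count_space \<R>)
         \<le> (\<integral>\<^sup>+Q. ennreal a * (emeasure \<omega> (E Q) * (emeasure \<sigma> (L Q) / emeasure lborel (L Q))\<^sup>2) \<partial>count_space \<R>)"
        by (rule nn_integral_mono) (use le_dilated in auto)
      also have "\<dots> = ennreal a * (\<integral>\<^sup>+Q. emeasure \<omega> (E Q) * (emeasure \<sigma> (L Q) / emeasure lborel (L Q))\<^sup>2 \<partial>count_space \<R>)"
        by (rule nn_integral_cmult) auto
      also have "\<dots> \<le> ennreal a * (ennreal (T\<^sup>2) * ennreal (D * (2 ^ Suc r * (D ^ j * measure \<sigma> M))))"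
      proof (rule mult_left_mono)
        define K where "K = cube c (2 powi (int (g * j) + k))"
        have LM: "L M = K" unfolding L_def Mc K_def by (rule dilate_hcube_pow2)
        have "(\<integral>\<^sup>+Q. emeasure \<omega> (E Q) * (emeasure \<sigma> (L Q) / emeasure lborel (L Q))\<^sup>2 \<partial>count_space \<R>)
           \<le> (\<integral>\<^sup>+x\<in>K. (maximal_function (weighted (indicator K) \<sigma>) x)\<^sup>2 \<partial>\<omega>)"
        proof (rule sum_le_testing_integral[OF lf cR])
          show "disjoint_family_on E \<R>"
            by (rule disjoint_family_on_mono[OF _ E(2)]) (use SP in \<open>auto simp: \<R>_def\<close>)
          show "E Q \<in> sets borel" if "Q \<in> \<R>" for Q using that E(1) SP by (auto simp: \<R>_def)
          show "K \<in> sets borel" by (simp add: K_def)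
          fix Q assume QR: "Q \<in> \<R>"
          then obtain c' k' where Q: "Q = hcube c' (2 powi k')" using hcubes[of Q] SP by (auto simp: \<R>_def)
          have LQ: "L Q = cube c' (2 powi (int (g * j) + k'))" unfolding L_def Q by (rule dilate_hcube_pow2)
          have "E Q \<subseteq> Q" using QR E(1) SP by (auto simp: \<R>_def)
          also have "Q \<subseteq> cube c' (2 powi k')" unfolding Q by (rule hcube_subset_cube)
          also have "\<dots> \<subseteq> L Q" unfolding LQ by (intro cube_mono power_int_increasing) auto
          finally have "E Q \<subseteq> L Q" .
          moreover have "L Q \<subseteq> K" unfolding LM[symmetric] L_def Q Mc
            by (rule dilate_mono) (use QR Q Mc in \<open>auto simp: \<R>_def\<close>)
          ultimately show "E Q \<subseteq> L Q \<and> L Q \<in> pow2_cubes \<and> L Q \<subseteq> K" unfolding LQ by simp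
        qed
        also have "\<dots> \<le> ennreal (T\<^sup>2) * emeasure \<sigma> (cube c (\<Gamma> * 2 powi (int (g * j) + k)))"
          unfolding K_def by (rule testing)
        also have "\<dots> \<le> ennreal (T\<^sup>2) * ennreal (D * (2 ^ Suc r * (D ^ j * measure \<sigma> M)))"
        proof (rule mult_left_mono)
          have "emeasure \<sigma> (cube c (\<Gamma> * 2 powi (int (g * j) + k))) \<le> emeasure \<sigma> (cube c (2 ^ g * 2 powi (int (g * j) + k)))"
            using g ss by (intro emeasure_mono cube_mono mult_right_mono) auto
          also have "cube c (2 ^ g * 2 powi (int (g * j) + k)) = dilate ((2 ^ g) ^ Suc j) M"
          proof -
            have "(2 powi (int (g * Suc j) + k) :: real) = 2 ^ g * 2 powi (int (g * j) + k)"
              by (simp add: power_int_add algebra_simps)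
            then show ?thesis unfolding Mc dilate_hcube_pow2 by simp
          qed
          also have "emeasure \<sigma> (dilate ((2 ^ g) ^ Suc j) M) = ennreal (measure \<sigma> (dilate ((2 ^ g) ^ Suc j) M))"
            unfolding Mc dilate_hcube_pow2 by (rule finc)
          also have "\<dots> \<le> ennreal (D * (2 ^ Suc r * (D ^ j * measure \<sigma> M)))"
          proof (rule ennreal_leI)
            have "measure \<sigma> (dilate ((2 ^ g) ^ Suc j) M) \<le> D * measure \<sigma> (dilate ((2 ^ g) ^ j) M)"
              using Mcls by (simp only: doubling_class_def)
            also have "\<dots> \<le> D * (2 ^ Suc r * (D ^ j * measure \<sigma> M))"
              by (rule mult_left_mono) (use Mcls D0 in \<open>simp_all only: doubling_class_def less_imp_le\<close>)
            finally show "measure \<sigma> (dilate ((2 ^ g) ^ Suc j) M) \<le> D * (2 ^ Suc r * (D ^ j * measure \<sigma> M))" .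
          qed
          finally show "emeasure \<sigma> (cube c (\<Gamma> * 2 powi (int (g * j) + k))) \<le> ennreal (D * (2 ^ Suc r * (D ^ j * measure \<sigma> M)))" .
        qed simp
        finally show "(\<integral>\<^sup>+Q. emeasure \<omega> (E Q) * (emeasure \<sigma> (L Q) / emeasure lborel (L Q))\<^sup>2 \<partial>count_space \<R>)
            \<le> ennreal (T\<^sup>2) * ennreal (D * (2 ^ Suc r * (D ^ j * measure \<sigma> M)))" .
      qed simp
      also have "\<dots> = ennreal (a * (T\<^sup>2 * (D * (2 ^ Suc r * (D ^ j * measure \<sigma> M)))))"
        using a0 D0 by (simp add: ennreal_mult)
      also have "a * (T\<^sup>2 * (D * (2 ^ Suc r * (D ^ j * measure \<sigma> M)))) = b j r * measure \<sigma> M"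
      proof -
        have "a = (1/2) ^ r * (1/2) ^ r * h ^ j / (D ^ j * D ^ j)"
          by (simp add: a_def h_def power_mult_distrib power_mult[symmetric] power2_eq_square mult_ac)
        moreover have "h ^ j / D ^ j = (1/2) ^ j"
          using h by (simp add: D_def power_mult_distrib power_divide)
        ultimately have "a * D ^ j = (1/2) ^ r * (1/2) ^ r * (1/2) ^ j"
          using D0 h by (simp add: field_simps)
        moreover have "(1/2) ^ r * 2 ^ r = (1::real)" by (simp add: power_mult_distrib[symmetric])
        ultimately have "a * D ^ j * 2 ^ r = (1/2) ^ r * (1/2) ^ j" by (simp add: mult_ac)
        then have "2 * D * T\<^sup>2 * measure \<sigma> M * (a * D ^ j * 2 ^ r) = 2 * D * T\<^sup>2 * measure \<sigma> M * ((1/2) ^ r * (1/2) ^ j)" by simp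
        then show ?thesis by (simp add: b_def mult_ac)
      qed
      also have "ennreal (b j r * measure \<sigma> M) = ennreal (b j r) * emeasure \<sigma> M"
        using finh[OF lf(1), of M] M SP D0 by (simp add: ennreal_mult b_def subset_iff)
      finally show "(\<integral>\<^sup>+Q. \<tau> Q \<partial>count_space {Q \<in> \<S>. Q \<subseteq> M}) \<le> ennreal (b j r) * emeasure \<sigma> M"
        unfolding \<R>_def .
    qed
    also have "\<dots> \<le> ennreal (b j r) * emeasure \<sigma> P"
      using P Qb ss by (intro mult_left_mono emeasure_mono) (auto simp: \<S>_def \<P>_def)
    finally show ?thesis .
  qed
  have "(\<integral>\<^sup>+Q. \<tau> Q \<partial>count_space \<P>)
      \<le> (\<integral>\<^sup>+Q. (\<integral>\<^sup>+j. (\<integral>\<^sup>+r. \<tau> Q * indicator {Q. cls j r Q} Q \<partial>count_space UNIV) \<partial>count_space UNIV) \<partial>count_space \<P>)"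
  proof (rule nn_integral_mono)
    fix Q assume "Q \<in> space (count_space \<P>)"
    then have Q: "Q \<in> \<P>" "Q \<in> \<Q>" using PQ by auto
    \<comment> \<open>A cell that is null for one of the measures may belong to no class, but then \<open>\<tau> Q = 0\<close>.\<close>
    show "\<tau> Q \<le> (\<integral>\<^sup>+j. (\<integral>\<^sup>+r. \<tau> Q * indicator {Q. cls j r Q} Q \<partial>count_space UNIV) \<partial>count_space UNIV)"
    proof (cases "measure \<sigma> Q = 0 \<or> measure \<omega> Q = 0")
      case True
      have "emeasure \<omega> (E Q) \<le> emeasure \<omega> Q"
        using E(1)[OF Q(2)] Qb[OF Q(2)] ss by (intro emeasure_mono) auto
      then have "\<tau> Q = 0"
        using True finh[OF lf(1) Q(2)] finh[OF lf(2) Q(2)] by (auto simp: \<tau>_def)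
      then show ?thesis by simp
    next
      case False
      obtain c k where Qc: "Q = hcube c (2 powi k)" using hcubes[OF Q(2)] by blast
      have "\<exists>j r. doubling_class \<sigma> (2 ^ g) D j r Q"
        unfolding Qc by (rule ex_doubling_class[OF lf A2])
          (use False in \<open>auto simp: Qc D_def h_def N_def zero_less_measure_iff\<close>)
      then obtain j r where "cls j r Q" by (auto simp: cls_def)
      then have "\<tau> Q = \<tau> Q * indicator {Q. cls j r Q} Q" by simp
      also have "\<dots> \<le> (\<integral>\<^sup>+r. \<tau> Q * indicator {Q. cls j r Q} Q \<partial>count_space UNIV)"
        by (rule nn_integral_ge_point) simp
      also have "\<dots> \<le> (\<integral>\<^sup>+j. (\<integral>\<^sup>+r. \<tau> Q * indicator {Q. cls j r Q} Q \<partial>count_space UNIV) \<partial>count_space UNIV)"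
        by (rule nn_integral_ge_point) simp
      finally show ?thesis .
    qed
  qed
  also have "\<dots> = (\<integral>\<^sup>+j. (\<integral>\<^sup>+r. (\<integral>\<^sup>+Q. \<tau> Q * indicator {Q. cls j r Q} Q \<partial>count_space \<P>) \<partial>count_space UNIV) \<partial>count_space UNIV)"
    by (subst nn_integral_count_space_nn_integral, simp, simp)
      (intro nn_integral_cong nn_integral_count_space_nn_integral, auto)
  also have "\<dots> \<le> (\<integral>\<^sup>+j. (\<integral>\<^sup>+r. ennreal (b j r) * emeasure \<sigma> P \<partial>count_space UNIV) \<partial>count_space UNIV)"
    by (intro nn_integral_mono class_bound)
  also have "\<dots> = (\<Sum>j. \<Sum>r. ennreal (b j r)) * emeasure \<sigma> P"
    by (simp add: nn_integral_count_space_nat nn_integral_multc)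
  also have "(\<Sum>j. \<Sum>r. ennreal (b j r)) = ennreal (8 * D * T\<^sup>2)"
  proof -
    have "(\<Sum>r. ennreal (b j r)) = ennreal (2 * D * T\<^sup>2 * 2 * (1/2) ^ j)" for j
      unfolding b_def
    proof (rule suminf_ennreal_eq)
      show "(\<lambda>r. 2 * D * T\<^sup>2 * (1/2) ^ r * (1/2) ^ j) sums (2 * D * T\<^sup>2 * 2 * (1/2) ^ j)"
        using geometric_sums[of "1/2::real"] by (intro sums_mult sums_mult2) simp
    qed (use D0 in simp)
    moreover have "(\<Sum>j. ennreal (2 * D * T\<^sup>2 * 2 * (1/2) ^ j)) = ennreal (2 * D * T\<^sup>2 * 2 * 2)"
    proof (rule suminf_ennreal_eq)
      show "(\<lambda>j. 2 * D * T\<^sup>2 * 2 * (1/2) ^ j) sums (2 * D * T\<^sup>2 * 2 * 2)"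
        using geometric_sums[of "1/2::real"] by (intro sums_mult) simp
    qed (use D0 in simp)
    ultimately show ?thesis by (simp add: mult.assoc)
  qed
  finally show ?thesis unfolding \<tau>_def \<P>_def D_def h_def N_def by (simp add: mult.assoc)
qed

section \<open>Linearisation over a laminar family\<close>

text \<open>Measurable linearisation of a maximum. Ties are broken by an enumeration of the family, so that
  each piece is a member minus countably many members.\<close>

lemma laminar_argmax_pieces:
  fixes A :: "'a set \<Rightarrow> ennreal"
  assumes lam: "laminar \<Q>" and sets: "\<Q> \<subseteq> sets M"
  obtains E where "\<And>Q. Q \<in> \<Q> \<Longrightarrow> E Q \<in> sets M \<and> E Q \<subseteq> Q" "disjoint_family_on E \<Q>"
    "\<And>x Q. Q \<in> \<Q> \<Longrightarrow> x \<in> Q \<Longrightarrow> \<exists>R\<in>\<Q>. x \<in> E R"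
    "\<And>x Q R. Q \<in> \<Q> \<Longrightarrow> x \<in> Q \<Longrightarrow> R \<in> \<Q> \<Longrightarrow> x \<in> E R \<Longrightarrow> A Q \<le> A R"
proof -
  have cQ: "countable \<Q>" using laminarD(1)[OF lam] .
  let ?i = "to_nat_on \<Q>"
  define pref where "pref Q R \<longleftrightarrow> A R < A Q \<or> (A R = A Q \<and> ?i Q \<le> ?i R)" for Q R
  define E where "E Q = Q - \<Union>{R \<in> \<Q>. \<not> pref Q R}" for Q
  have E: "x \<in> E Q \<longleftrightarrow> x \<in> Q \<and> (\<forall>R\<in>\<Q>. x \<in> R \<longrightarrow> pref Q R)" for x Q
    by (auto simp: E_def)
  show ?thesis
  proof (rule that)
    show "E Q \<in> sets M \<and> E Q \<subseteq> Q" if "Q \<in> \<Q>" for Q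
    proof -
      have "countable {R \<in> \<Q>. \<not> pref Q R}" by (rule countable_subset[OF _ cQ]) auto
      then have "\<Union>{R \<in> \<Q>. \<not> pref Q R} \<in> sets M"
        using sets by (intro sets.countable_Union) auto
      then show ?thesis using that sets by (auto simp: E_def)
    qed
    show "disjoint_family_on E \<Q>"
      unfolding disjoint_family_on_def
    proof (intro ballI impI)
      fix Q R assume QR: "Q \<in> \<Q>" "R \<in> \<Q>" "Q \<noteq> R"
      have "False" if "x \<in> E Q" "x \<in> E R" for x
      proof -
        have QR': "pref Q R" and RQ: "pref R Q" using that QR by (simp_all add: E)
        have "A R \<le> A Q" using QR' unfolding pref_def by (elim disjE) simp_all
        moreover have "A Q \<le> A R" using RQ unfolding pref_def by (elim disjE) simp_all
        ultimately have "A Q = A R" by (rule antisym[rotated])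
        then have "?i Q = ?i R" using QR' RQ by (simp add: pref_def)
        then show False using QR cQ by (simp add: to_nat_on_inj)
      qed
      then show "E Q \<inter> E R = {}" by blast
    qed
    show "A Q \<le> A R" if "Q \<in> \<Q>" "x \<in> Q" "R \<in> \<Q>" "x \<in> E R" for x Q R
      using that by (auto simp: E pref_def)
    show "\<exists>R\<in>\<Q>. x \<in> E R" if "Q \<in> \<Q>" "x \<in> Q" for x Q
    proof -
      let ?F = "{Q \<in> \<Q>. x \<in> Q}"
      define a where "a = Max (A ` ?F)"
      have fin: "finite (A ` ?F)" using laminarD(3)[OF lam] by simp
      have "a \<in> A ` ?F" unfolding a_def by (rule Max_in[OF fin]) (use that in auto)
      then obtain R0 where "R0 \<in> ?F \<and> A R0 = a" by auto
      then obtain R where R: "R \<in> ?F \<and> A R = a" "\<And>S. S \<in> ?F \<and> A S = a \<Longrightarrow> ?i R \<le> ?i S"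
        using ex_has_least_nat[of "\<lambda>R. R \<in> ?F \<and> A R = a" R0 ?i] by blast
      have "pref R S" if "S \<in> \<Q>" "x \<in> S" for S
      proof -
        have "A S \<le> a" unfolding a_def by (rule Max_ge[OF fin]) (use that in auto)
        then show ?thesis using R that by (auto simp: pref_def order.order_iff_strict)
      qed
      then show ?thesis using R(1) by (auto simp: E)
    qed
  qed
qed

text \<open>The linearised square is \<open>\<Sum>\<^sub>Q \<tau>\<^sub>Q m\<^sub>Q\<^sup>2\<close> with the \<open>\<sigma>\<close>-averages \<open>m\<^sub>Q\<close> of \<open>f\<close>, because
  \<open>|Q|\<^sup>-\<^sup>1 \<sigma>(Q)\<close> times the \<open>\<sigma>\<close>-average is the Lebesgue-normalised one. The packing of \<open>\<tau>\<close> and the Carleson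
  embedding then finish the estimate.\<close>

theorem laminar_maximal_bound:
  fixes \<sigma> \<omega> :: "(real ^ 'n) measure" and f :: "real ^ 'n \<Rightarrow> ennreal"
  assumes lf: "locally_finite_borel \<sigma>" "locally_finite_borel \<omega>"
    and A2: "A2_const \<sigma> \<omega> \<noteq> \<infinity>"
    and testing: "\<And>(c :: real ^ 'n) k.
        (\<integral>\<^sup>+x\<in>cube c (2 powi k). (maximal_function (weighted (indicator (cube c (2 powi k))) \<sigma>) x)\<^sup>2 \<partial>\<omega>)
          \<le> ennreal (T\<^sup>2) * emeasure \<sigma> (cube c (\<Gamma> * 2 powi k))"
    and g: "\<Gamma> \<le> 2 ^ g"
    and lam: "laminar \<Q>" and hcubes: "\<And>Q. Q \<in> \<Q> \<Longrightarrow> \<exists>c k. Q = hcube c (2 powi k)"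
    and f: "f \<in> borel_measurable borel"
  shows "(\<integral>\<^sup>+x. (SUP Q\<in>\<Q>. (\<integral>\<^sup>+y\<in>Q. f y \<partial>\<sigma>) / emeasure lborel Q * indicator Q x)\<^sup>2 \<partial>\<omega>)
      \<le> 32 * ennreal (16 * ((2 ^ g) ^ CARD('n))\<^sup>2 * T\<^sup>2) * (\<integral>\<^sup>+x. (f x)\<^sup>2 \<partial>\<sigma>)"
proof -
  have ss: "sets \<sigma> = sets borel" "sets \<omega> = sets borel" using lf by (auto simp: locally_finite_borel_def)
  have Qb: "Q \<in> sets borel" if "Q \<in> \<Q>" for Q using hcubes[OF that] hcube_borel by metis
  have fin: "emeasure \<sigma> Q < \<infinity>" if Q: "Q \<in> \<Q>" for Q
  proof -
    obtain c k where Q: "Q = hcube c (2 powi k)" using hcubes[OF Q] by blast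
    have "emeasure \<sigma> Q \<le> emeasure \<sigma> (cube c (2 powi k))"
      unfolding Q using ss by (intro emeasure_mono hcube_subset_cube) auto
    also have "\<dots> < \<infinity>" by (rule emeasure_cube_finite[OF lf(1)])
    finally show ?thesis .
  qed
  define A where "A Q = (\<integral>\<^sup>+y\<in>Q. f y \<partial>\<sigma>) / emeasure lborel Q" for Q
  define \<tau> where "\<tau> E Q = emeasure \<omega> (E Q) * (emeasure \<sigma> Q / emeasure lborel Q)\<^sup>2" for E :: "(real ^ 'n) set \<Rightarrow> _" and Q
  have Qs: "\<Q> \<subseteq> sets \<omega>" using Qb ss by auto
  obtain E where E: "\<And>Q. Q \<in> \<Q> \<Longrightarrow> E Q \<in> sets \<omega> \<and> E Q \<subseteq> Q" "disjoint_family_on E \<Q>"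
    "\<And>x Q. Q \<in> \<Q> \<Longrightarrow> x \<in> Q \<Longrightarrow> \<exists>R\<in>\<Q>. x \<in> E R"
    "\<And>x Q R. Q \<in> \<Q> \<Longrightarrow> x \<in> Q \<Longrightarrow> R \<in> \<Q> \<Longrightarrow> x \<in> E R \<Longrightarrow> A Q \<le> A R"
    using laminar_argmax_pieces[OF lam Qs, of A] by metis
  have "(\<integral>\<^sup>+x. (SUP Q\<in>\<Q>. A Q * indicator Q x)\<^sup>2 \<partial>\<omega>)
      \<le> (\<integral>\<^sup>+x. (\<integral>\<^sup>+Q. (A Q)\<^sup>2 * indicator (E Q) x \<partial>count_space \<Q>) \<partial>\<omega>)"
  proof (rule nn_integral_mono)
    fix x
    show "(SUP Q\<in>\<Q>. A Q * indicator Q x)\<^sup>2 \<le> (\<integral>\<^sup>+Q. (A Q)\<^sup>2 * indicator (E Q) x \<partial>count_space \<Q>)"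
    proof (cases "\<exists>Q\<in>\<Q>. x \<in> Q")
      case True
      then obtain R where R: "R \<in> \<Q>" "x \<in> E R" using E(3) by blast
      have "(SUP Q\<in>\<Q>. A Q * indicator Q x) \<le> A R"
      proof (rule SUP_least)
        fix Q assume "Q \<in> \<Q>"
        then show "A Q * indicator Q x \<le> A R" using E(4)[of Q x R] R by (cases "x \<in> Q") auto
      qed
      then have "(SUP Q\<in>\<Q>. A Q * indicator Q x)\<^sup>2 \<le> (A R)\<^sup>2" by (intro power_mono) auto
      also have "\<dots> = (\<integral>\<^sup>+Q. (A Q)\<^sup>2 * indicator (E Q) x \<partial>count_space \<Q>)"
        by (rule nn_integral_count_space_disjoint[OF E(2) R, symmetric])
      finally show ?thesis .
    next
      case False
      then have "(SUP Q\<in>\<Q>. A Q * indicator Q x) \<le> 0" by (intro SUP_least) auto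
      then show ?thesis by simp
    qed
  qed
  also have "\<dots> = (\<integral>\<^sup>+Q. emeasure \<omega> (E Q) * (A Q)\<^sup>2 \<partial>count_space \<Q>)"
    by (rule nn_integral_disjoint_pieces[symmetric]) (use laminarD(1)[OF lam] E(1) in auto)
  also have "\<dots> \<le> (\<integral>\<^sup>+Q. \<tau> E Q * ((\<integral>\<^sup>+y\<in>Q. f y \<partial>\<sigma>) / emeasure \<sigma> Q)\<^sup>2 \<partial>count_space \<Q>)"
  proof (rule nn_integral_mono)
    fix Q assume "Q \<in> space (count_space \<Q>)"
    then have Q: "Q \<in> \<Q>" by simp
    have "A Q = (emeasure \<sigma> Q / emeasure lborel Q) * ((\<integral>\<^sup>+y\<in>Q. f y \<partial>\<sigma>) / emeasure \<sigma> Q)"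
    proof (cases "emeasure \<sigma> Q = 0")
      case True
      then have "(\<integral>\<^sup>+y\<in>Q. f y \<partial>\<sigma>) = 0" using Qb[OF Q] ss by (intro nn_integral_null_set) auto
      then show ?thesis by (simp add: A_def)
    next
      case False
      have "((\<integral>\<^sup>+y\<in>Q. f y \<partial>\<sigma>) / emeasure \<sigma> Q) * emeasure \<sigma> Q = (\<integral>\<^sup>+y\<in>Q. f y \<partial>\<sigma>)"
        using False fin[OF Q] by (simp add: ennreal_divide_times mult_divide_eq_ennreal)
      then have "A Q = ((\<integral>\<^sup>+y\<in>Q. f y \<partial>\<sigma>) / emeasure \<sigma> Q) * emeasure \<sigma> Q / emeasure lborel Q"
        by (simp only: A_def)
      also have "\<dots> = ((\<integral>\<^sup>+y\<in>Q. f y \<partial>\<sigma>) / emeasure \<sigma> Q) * (emeasure \<sigma> Q / emeasure lborel Q)"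
        by (rule ennreal_times_divide[symmetric])
      finally show ?thesis by (simp only: mult.commute)
    qed
    then show "emeasure \<omega> (E Q) * (A Q)\<^sup>2 \<le> \<tau> E Q * ((\<integral>\<^sup>+y\<in>Q. f y \<partial>\<sigma>) / emeasure \<sigma> Q)\<^sup>2"
      by (simp add: \<tau>_def power_mult_distrib mult_ac)
  qed
  also have "\<dots> \<le> 32 * ennreal (16 * ((2 ^ g) ^ CARD('n))\<^sup>2 * T\<^sup>2) * (\<integral>\<^sup>+x. (f x)\<^sup>2 \<partial>\<sigma>)"
  proof (rule carleson_embedding[OF lam])
    show "\<Q> \<subseteq> sets \<sigma>" using Qb ss by auto
    show "f \<in> borel_measurable \<sigma>" using f measurable_cong_sets[OF ss(1) refl] by blast
    show "(\<integral>\<^sup>+Q. \<tau> E Q \<partial>count_space {Q \<in> \<Q>. Q \<subseteq> P}) \<le> ennreal (16 * ((2 ^ g) ^ CARD('n))\<^sup>2 * T\<^sup>2) * emeasure \<sigma> P"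
      if "P \<in> \<Q>" for P
      unfolding \<tau>_def
      by (rule dilated_testing_imp_packing[OF lf A2 testing g lam hcubes]) (use E ss that in auto)
  qed (rule fin)
  finally show ?thesis unfolding A_def .
qed

section \<open>Shifted dyadic grids\<close>

text \<open>The one-third trick: a coordinate \<open>i\<close> with \<open>a i\<close> uses endpoints shifted by a third of the cell
  length. The sign alternates with the level because \<open>\<plusminus>1/3\<close> at level \<open>k\<close> is \<open>\<plusminus>1/6\<close> in units of level
  \<open>k + 1\<close>, which agrees with \<open>\<mp>1/3\<close> modulo one half; hence the levels are nested.\<close>

definition grid_shift :: "('n \<Rightarrow> bool) \<Rightarrow> int \<Rightarrow> 'n \<Rightarrow> real" where
  "grid_shift a k i = (if a i then (if even k then 1 / 3 else - 1 / 3) else 0)"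

definition grid_cell :: "('n::finite \<Rightarrow> bool) \<Rightarrow> int \<Rightarrow> ('n \<Rightarrow> int) \<Rightarrow> (real ^ 'n) set" where
  "grid_cell a k z = hcube (\<chi> i. 2 powi k * (real_of_int (z i) + 1 / 2 + grid_shift a k i)) (2 powi k)"

definition grid_index :: "('n::finite \<Rightarrow> bool) \<Rightarrow> int \<Rightarrow> real ^ 'n \<Rightarrow> 'n \<Rightarrow> int" where
  "grid_index a k x i = \<lfloor>x $ i / 2 powi k - grid_shift a k i\<rfloor>"

text \<open>Only levels in a finite window are kept, so that every point lies in finitely many cells.\<close>

definition grid :: "('n::finite \<Rightarrow> bool) \<Rightarrow> nat \<Rightarrow> (real ^ 'n) set set" where
  "grid a N = (\<lambda>(k, z). grid_cell a k z) ` ({- int N..int N} \<times> UNIV)"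

lemma mem_grid_cell: "x \<in> grid_cell a k z \<longleftrightarrow> z = grid_index a k x"
proof -
  have "2 powi k * (real_of_int (z i) + 1 / 2 + grid_shift a k i) - 2 powi k / 2 \<le> x $ i \<and>
        x $ i < 2 powi k * (real_of_int (z i) + 1 / 2 + grid_shift a k i) + 2 powi k / 2
      \<longleftrightarrow> z i = grid_index a k x i" for i
  proof -
    define y where "y = x $ i / 2 powi k"
    have x: "x $ i = 2 powi k * y" by (simp add: y_def)
    have p: "(2 powi k :: real) > 0" by simp
    have "2 powi k * (real_of_int (z i) + 1 / 2 + grid_shift a k i) - 2 powi k / 2 \<le> x $ i
        \<longleftrightarrow> 2 powi k * (real_of_int (z i) + grid_shift a k i) \<le> 2 powi k * y"
      unfolding x by (simp add: algebra_simps)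
    also have "\<dots> \<longleftrightarrow> real_of_int (z i) + grid_shift a k i \<le> y"
      using p by (rule mult_le_cancel_left_pos)
    finally have 1: "2 powi k * (real_of_int (z i) + 1 / 2 + grid_shift a k i) - 2 powi k / 2 \<le> x $ i
        \<longleftrightarrow> real_of_int (z i) + grid_shift a k i \<le> y" .
    have "x $ i < 2 powi k * (real_of_int (z i) + 1 / 2 + grid_shift a k i) + 2 powi k / 2
        \<longleftrightarrow> 2 powi k * y < 2 powi k * (real_of_int (z i) + 1 + grid_shift a k i)"
      unfolding x by (simp add: algebra_simps)
    also have "\<dots> \<longleftrightarrow> y < real_of_int (z i) + 1 + grid_shift a k i"
      using p by (rule mult_less_cancel_left_pos)
    finally have 2: "x $ i < 2 powi k * (real_of_int (z i) + 1 / 2 + grid_shift a k i) + 2 powi k / 2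
        \<longleftrightarrow> y < real_of_int (z i) + 1 + grid_shift a k i" .
    show ?thesis unfolding 1 2 grid_index_def y_def[symmetric] by linarith
  qed
  then show ?thesis unfolding grid_cell_def hcube_def by (simp add: fun_eq_iff)
qed

lemma grid_index_Suc:
  assumes "grid_index a k x = grid_index a k y"
  shows "grid_index a (k + 1) x = grid_index a (k + 1) y"
proof
  fix i
  define u v where "u = x $ i / 2 powi k - grid_shift a k i" and "v = y $ i / 2 powi k - grid_shift a k i"
  have uv: "\<lfloor>u\<rfloor> = \<lfloor>v\<rfloor>" using assms by (auto simp: grid_index_def u_def v_def fun_eq_iff)
  obtain m :: int where m: "grid_shift a k i / 2 - grid_shift a (k + 1) i = m / 2"
  proof (cases "a i")
    case True
    show ?thesis by (rule that[of "if even k then 1 else - 1"]) (use True in \<open>auto simp: grid_shift_def\<close>)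
  next
    case False
    show ?thesis by (rule that[of 0]) (use False in \<open>auto simp: grid_shift_def\<close>)
  qed
  have *: "w / 2 powi (k + 1) - grid_shift a (k + 1) i = (w / 2 powi k - grid_shift a k i + m) / 2" for w :: real
  proof -
    have "w / 2 powi (k + 1) = w / 2 powi k / 2" by (simp add: power_int_add)
    then show ?thesis using m by (simp only: add_divide_distrib diff_divide_distrib)
  qed
  have fl: "\<lfloor>(t + real_of_int m) / 2\<rfloor> = (\<lfloor>t\<rfloor> + m) div 2" for t :: real
    using floor_divide_real_eq_div[of 2 "t + real_of_int m"] by simp
  show "grid_index a (k + 1) x i = grid_index a (k + 1) y i"
    unfolding grid_index_def * u_def[symmetric] v_def[symmetric] fl uv ..
qed

lemma grid_index_mono:
  assumes "grid_index a k x = grid_index a k y" "k \<le> k'"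
  shows "grid_index a k' x = grid_index a k' y"
  using assms(2,1) by (induction k' rule: int_ge_induct) (auto intro: grid_index_Suc)

lemma grid_memE:
  assumes "Q \<in> grid a N"
  obtains k z where "Q = grid_cell a k z" "\<bar>k\<bar> \<le> int N"
  using assms by (auto simp: grid_def)

lemma grid_hcube:
  assumes "Q \<in> grid a N"
  shows "\<exists>c k. Q = hcube c (2 powi k)"
proof -
  obtain k z where "Q = grid_cell a k z" using assms by (rule grid_memE)
  then show ?thesis unfolding grid_cell_def by blast
qed

lemma laminar_grid: "laminar (grid a N)"
  unfolding laminar_def
proof (intro conjI allI ballI)
  show "countable (grid a N)" unfolding grid_def by (intro countable_image countable_SIGMA) auto
  show "{} \<notin> grid a N"
  proof
    assume "{} \<in> grid a N"
    then obtain k z where kz: "{} = grid_cell a k z" by (rule grid_memE)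
    define c where "c = (\<chi> i. 2 powi k * (real_of_int (z i) + 1 / 2 + grid_shift a k i))"
    have "c \<in> hcube c (2 powi k)" by (simp add: hcube_def)
    then show False using kz unfolding grid_cell_def c_def by blast
  qed
  fix x
  have "{Q \<in> grid a N. x \<in> Q} \<subseteq> (\<lambda>k. grid_cell a k (grid_index a k x)) ` {- int N..int N}"
    by (auto simp: grid_def mem_grid_cell)
  then show "finite {Q \<in> grid a N. x \<in> Q}" by (rule finite_subset) simp
next
  fix Q R assume "Q \<in> grid a N" "R \<in> grid a N"
  then obtain k z l w where Q: "Q = grid_cell a k z" and R: "R = grid_cell a l w"
    by (metis grid_memE)
  have "Q \<subseteq> R" if "k \<le> l" "x \<in> Q" "x \<in> R" for x
    using that grid_index_mono[OF _ that(1)] unfolding Q R by (auto simp: mem_grid_cell)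
  moreover have "R \<subseteq> Q" if "l \<le> k" "x \<in> Q" "x \<in> R" for x
    using that grid_index_mono[OF _ that(1)] unfolding Q R by (auto simp: mem_grid_cell)
  ultimately show "Q \<inter> R = {} \<or> Q \<subseteq> R \<or> R \<subseteq> Q"
    by (cases "k \<le> l") (auto simp: disjoint_iff)
qed

text \<open>In each coordinate the endpoints of the unshifted and of the shifted cells are at least a third of
  a cell length apart, so an interval of a quarter of that length avoids one of the two sets of endpoints.\<close>

lemma cube_subset_grid_cell:
  obtains a z where "cube c (2 powi k) \<subseteq> grid_cell a (k + 2) z"
proof -
  define u where "u i = (c $ i - 2 powi k / 2) / 2 powi (k + 2)" for i
  have pw: "(2 powi (k + 2) :: real) = 4 * 2 powi k" by (simp add: power_int_add)
  have "\<exists>b m. real_of_int m \<le> u i - grid_shift (\<lambda>_. b) (k + 2) i \<and> u i + 1 / 4 - grid_shift (\<lambda>_. b) (k + 2) i < m + 1" for i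
  proof -
    define q where "q = \<lfloor>u i\<rfloor>"
    have q: "real_of_int q \<le> u i" "u i < real_of_int q + 1" unfolding q_def by linarith+
    show ?thesis
    proof (cases "u i + 1 / 4 < real_of_int q + 1")
      case True
      then show ?thesis using q
        by (intro exI[of _ False] exI[of _ q]) (simp add: grid_shift_def)
    next
      case False
      have "u i - 1 / 3 \<ge> q" "u i + 1 / 4 - 1 / 3 < q + 1"
        "u i + 1 / 3 \<ge> q + 1" "u i + 1 / 4 + 1 / 3 < q + 1 + 1"
        using False q by linarith+
      then show ?thesis
        by (intro exI[of _ True] exI[of _ "if even k then q else q + 1"]) (simp add: grid_shift_def)
    qed
  qed
  then obtain b m where bm: "\<And>i. real_of_int (m i) \<le> u i - grid_shift (\<lambda>_. b i) (k + 2) i \<and>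
      u i + 1 / 4 - grid_shift (\<lambda>_. b i) (k + 2) i < m i + 1" by metis
  have gs: "grid_shift (\<lambda>_. b i) (k + 2) i = grid_shift b (k + 2) i" for i by (simp add: grid_shift_def)
  have "cube c (2 powi k) \<subseteq> grid_cell b (k + 2) m"
  proof
    fix x assume x: "x \<in> cube c (2 powi k)"
    have "m i = grid_index b (k + 2) x i" for i
    proof -
      have lo: "c $ i - 2 powi k / 2 \<le> x $ i" and hi: "x $ i \<le> c $ i + 2 powi k / 2" using x by (auto simp: mem_cube)
      have "u i \<le> x $ i / 2 powi (k + 2)" unfolding u_def using lo by (intro divide_right_mono) auto
      moreover have "x $ i / 2 powi (k + 2) \<le> (c $ i + 2 powi k / 2) / 2 powi (k + 2)"
        using hi by (intro divide_right_mono) auto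
      moreover have "(c $ i + 2 powi k / 2) / 2 powi (k + 2) = u i + 1 / 4"
        unfolding u_def pw by (simp add: field_simps)
      ultimately show ?thesis using bm[of i] unfolding gs grid_index_def by linarith
    qed
    then show "x \<in> grid_cell b (k + 2) m" by (simp add: mem_grid_cell fun_eq_iff)
  qed
  then show ?thesis by (rule that)
qed

lemma power2_SUP_le:
  fixes f :: "nat \<Rightarrow> ennreal"
  assumes "incseq f"
  shows "(SUP n. f n)\<^sup>2 \<le> (SUP n. (f n)\<^sup>2)"
proof -
  have "(SUP n. f n)\<^sup>2 = (SUP n. f n * (SUP m. f m))"
    by (simp add: power2_eq_square SUP_mult_right_ennreal)
  also have "\<dots> = (SUP n. SUP m. f n * f m)" by (simp add: SUP_mult_left_ennreal)
  also have "\<dots> \<le> (SUP n. (f n)\<^sup>2)"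
  proof (intro SUP_least)
    fix n m
    have "f n * f m \<le> (f (max n m))\<^sup>2"
      unfolding power2_eq_square by (intro mult_mono incseqD[OF assms]) auto
    also have "\<dots> \<le> (SUP n. (f n)\<^sup>2)" by (rule SUP_upper) simp
    finally show "f n * f m \<le> (SUP n. (f n)\<^sup>2)" .
  qed
  finally show ?thesis .
qed

definition grid_maximal :: "(real ^ 'n) measure \<Rightarrow> (real ^ 'n \<Rightarrow> ennreal) \<Rightarrow> ('n \<Rightarrow> bool) \<Rightarrow> nat \<Rightarrow> real ^ 'n \<Rightarrow> ennreal" where
  "grid_maximal \<sigma> f a N x = (SUP Q\<in>grid a N. (\<integral>\<^sup>+y\<in>Q. f y \<partial>\<sigma>) / emeasure lborel Q * indicator Q x)"

lemma grid_maximal_measurable [measurable]: "grid_maximal \<sigma> f a N \<in> borel_measurable borel"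
  unfolding grid_maximal_def[abs_def]
proof (rule borel_measurable_SUP)
  show "countable (grid a N)" by (rule laminarD(1)[OF laminar_grid])
  show "(\<lambda>x. (\<integral>\<^sup>+y\<in>Q. f y \<partial>\<sigma>) / emeasure lborel Q * indicator Q x) \<in> borel_measurable borel"
    if Q: "Q \<in> grid a N" for Q
  proof -
    obtain k z where "Q = grid_cell a k z" using Q by (rule grid_memE)
    then have "Q \<in> sets borel" by (simp add: grid_cell_def)
    then show ?thesis by measurable
  qed
qed

lemma incseq_grid_maximal: "incseq (\<lambda>N. grid_maximal \<sigma> f a N x)"
  unfolding incseq_def grid_maximal_def grid_def
  by (intro allI impI SUP_subset_mono image_mono Sigma_mono) auto

text \<open>A cube of side \<open>2\<^sup>k\<close> lies in a cell of side \<open>4 \<cdot> 2\<^sup>k\<close>, which costs the ratio \<open>4\<^sup>n\<close> of the volumes. The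
  grid may depend on \<open>x\<close>; as there are only \<open>2\<^sup>n\<close> grids, this is repaired by summing over them.\<close>

lemma maximal_function_le_grid_maximal:
  fixes \<sigma> :: "(real ^ 'n) measure"
  assumes s: "sets \<sigma> = sets borel" and f: "f \<in> borel_measurable \<sigma>"
  shows "\<exists>a. maximal_function (weighted f \<sigma>) x \<le> ennreal (4 ^ CARD('n)) * (SUP N. grid_maximal \<sigma> (\<lambda>x. ennreal \<bar>f x\<bar>) a N x)"
proof -
  define W where "W a = (SUP N. grid_maximal \<sigma> (\<lambda>x. ennreal \<bar>f x\<bar>) a N x)" for a
  have "Max (range W) \<in> range W" by (rule Max_in) auto
  then obtain a0 where "Max (range W) = W a0" by (rule rangeE)
  then have a0: "W a0 = Max (range W)" ..
  have "maximal_function (weighted f \<sigma>) x \<le> ennreal (4 ^ CARD('n)) * W a0"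
    unfolding maximal_function_def
  proof (rule SUP_least)
    fix Q assume "Q \<in> {Q \<in> pow2_cubes. x \<in> Q}"
    then obtain c k where Q: "Q = cube c (2 powi k)" and x: "x \<in> Q" by (auto elim: pow2_cubesE)
    obtain a z where P: "Q \<subseteq> grid_cell a (k + 2) z" unfolding Q by (rule cube_subset_grid_cell)
    let ?P = "grid_cell a (k + 2) z"
    let ?I = "\<integral>\<^sup>+y\<in>?P. ennreal \<bar>f y\<bar> \<partial>\<sigma>"
    define v :: real where "v = (2 powi k) ^ CARD('n)"
    have v: "v > 0" by (simp add: v_def)
    have volQ: "emeasure lborel Q = ennreal v" unfolding Q v_def by (rule emeasure_lborel_cube) simp
    have "(2 powi (k + 2) :: real) = 4 * 2 powi k" by (simp add: power_int_add)
    then have volP: "emeasure lborel ?P = ennreal (4 ^ CARD('n) * v)"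
      unfolding grid_cell_def v_def by (simp add: emeasure_lborel_hcube power_mult_distrib)
    have "total_variation (weighted f \<sigma>) Q \<le> (\<integral>\<^sup>+y\<in>Q. ennreal \<bar>f y\<bar> \<partial>\<sigma>)"
      by (rule total_variation_weighted_le[OF s f])
    also have "\<dots> \<le> ?I" using P by (intro nn_integral_mono) (auto simp: indicator_def)
    finally have "total_variation (weighted f \<sigma>) Q / emeasure lborel Q \<le> ?I / ennreal v"
      unfolding volQ by (rule divide_right_mono_ennreal)
    also have "?I / ennreal v = ennreal (4 ^ CARD('n)) * (?I / emeasure lborel ?P)"
    proof -
      have "ennreal (4 ^ CARD('n)) * (?I / ennreal (4 ^ CARD('n) * v)) = ?I * (ennreal (4 ^ CARD('n)) / ennreal (4 ^ CARD('n) * v))"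
        unfolding ennreal_times_divide by (simp only: mult.commute)
      also have "ennreal (4 ^ CARD('n)) / ennreal (4 ^ CARD('n) * v) = ennreal (1 / v)"
        using v by (subst divide_ennreal) auto
      also have "?I * ennreal (1 / v) = ?I / ennreal v"
      proof -
        have "ennreal (1 / v) = 1 / ennreal v" using v divide_ennreal[of 1 v] by simp
        then show ?thesis by (simp only: ennreal_times_divide mult_1_right)
      qed
      finally show ?thesis unfolding volP by simp
    qed
    also have "\<dots> \<le> ennreal (4 ^ CARD('n)) * W a0"
    proof (rule mult_left_mono)
      have mem: "?P \<in> grid a (nat \<bar>k + 2\<bar>)" unfolding grid_def by (rule image_eqI[of _ _ "(k + 2, z)"]) auto
      have "?I / emeasure lborel ?P = ?I / emeasure lborel ?P * indicator ?P x" using P x by auto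
      also have "\<dots> \<le> grid_maximal \<sigma> (\<lambda>x. ennreal \<bar>f x\<bar>) a (nat \<bar>k + 2\<bar>) x"
        unfolding grid_maximal_def by (rule SUP_upper[OF mem])
      also have "\<dots> \<le> W a" unfolding W_def by (rule SUP_upper) simp
      also have "\<dots> \<le> W a0" unfolding a0 by (rule Max_ge) auto
      finally show "?I / emeasure lborel ?P \<le> W a0" .
    qed simp
    finally show "total_variation (weighted f \<sigma>) Q / emeasure lborel Q \<le> ennreal (4 ^ CARD('n)) * W a0" .
  qed
  then show ?thesis unfolding W_def by blast
qed

section \<open>Comparison of the constants\<close>

text \<open>The bound for one grid does not depend on the window of levels, so monotone convergence removes
  the window. The maximal function is replaced pointwise by the sum over the grids before integrals are
  split, because that sum is visibly measurable.\<close>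

theorem norm_bound_of_dilated_testing:
  fixes \<sigma> \<omega> :: "(real ^ 'n) measure"
  assumes lf: "locally_finite_borel \<sigma>" "locally_finite_borel \<omega>"
    and A2: "A2_const \<sigma> \<omega> \<noteq> \<infinity>"
    and testing: "\<And>(c :: real ^ 'n) k.
        (\<integral>\<^sup>+x\<in>cube c (2 powi k). (maximal_function (weighted (indicator (cube c (2 powi k))) \<sigma>) x)\<^sup>2 \<partial>\<omega>)
          \<le> ennreal (T\<^sup>2) * emeasure \<sigma> (cube c (\<Gamma> * 2 powi k))"
    and g: "\<Gamma> \<le> 2 ^ g"
    and f: "f \<in> borel_measurable \<sigma>"
  shows "(\<integral>\<^sup>+x. (maximal_function (weighted f \<sigma>) x)\<^sup>2 \<partial>\<omega>)
      \<le> ennreal (512 * 32 ^ CARD('n) * ((2 ^ g) ^ CARD('n))\<^sup>2 * T\<^sup>2) * (\<integral>\<^sup>+x. ennreal (\<bar>f x\<bar>\<^sup>2) \<partial>\<sigma>)"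
proof -
  define F where "F x = ennreal \<bar>f x\<bar>" for x
  define N where "N = CARD('n)"
  define B where "B = 16 * ((2 ^ g) ^ N)\<^sup>2 * T\<^sup>2"
  define W where "W a x = (SUP N. grid_maximal \<sigma> F a N x)" for a x
  have ss: "sets \<sigma> = sets borel" "sets \<omega> = sets borel" using lf by (auto simp: locally_finite_borel_def)
  have fb: "f \<in> borel_measurable borel" using f measurable_cong_sets[OF ss(1) refl] by blast
  have Fb: "F \<in> borel_measurable borel" unfolding F_def[abs_def] using fb by measurable
  have gm: "grid_maximal \<sigma> F a M \<in> borel_measurable \<omega>" for a M
    using grid_maximal_measurable measurable_cong_sets[OF ss(2) refl] by blast
  have F2: "(\<integral>\<^sup>+x. (F x)\<^sup>2 \<partial>\<sigma>) = (\<integral>\<^sup>+x. ennreal (\<bar>f x\<bar>\<^sup>2) \<partial>\<sigma>)"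
    by (simp add: F_def ennreal_power)
  have W_bound: "(\<integral>\<^sup>+x. (W a x)\<^sup>2 \<partial>\<omega>) \<le> 32 * ennreal B * (\<integral>\<^sup>+x. (F x)\<^sup>2 \<partial>\<sigma>)" for a
  proof -
    have "(\<integral>\<^sup>+x. (W a x)\<^sup>2 \<partial>\<omega>) \<le> (\<integral>\<^sup>+x. (SUP M. (grid_maximal \<sigma> F a M x)\<^sup>2) \<partial>\<omega>)"
      unfolding W_def by (intro nn_integral_mono power2_SUP_le incseq_grid_maximal)
    also have "\<dots> = (SUP M. (\<integral>\<^sup>+x. (grid_maximal \<sigma> F a M x)\<^sup>2 \<partial>\<omega>))"
    proof (rule nn_integral_monotone_convergence_SUP)
      show "incseq (\<lambda>M x. (grid_maximal \<sigma> F a M x)\<^sup>2)"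
        using incseq_grid_maximal[of \<sigma> F a] unfolding incseq_def le_fun_def
        by (auto intro!: power_mono)
      show "(\<lambda>x. (grid_maximal \<sigma> F a M x)\<^sup>2) \<in> borel_measurable \<omega>" for M
        using gm by measurable
    qed
    also have "\<dots> \<le> 32 * ennreal B * (\<integral>\<^sup>+x. (F x)\<^sup>2 \<partial>\<sigma>)"
    proof (rule SUP_least)
      fix M
      show "(\<integral>\<^sup>+x. (grid_maximal \<sigma> F a M x)\<^sup>2 \<partial>\<omega>) \<le> 32 * ennreal B * (\<integral>\<^sup>+x. (F x)\<^sup>2 \<partial>\<sigma>)"
        unfolding grid_maximal_def B_def N_def
        by (rule laminar_maximal_bound[OF lf A2 testing g laminar_grid grid_hcube Fb])
    qed
    finally show ?thesis .
  qed
  have W_meas: "W a \<in> borel_measurable \<omega>" for a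
    unfolding W_def[abs_def] by (rule borel_measurable_SUP) (auto intro: gm)
  have "(\<integral>\<^sup>+x. (maximal_function (weighted f \<sigma>) x)\<^sup>2 \<partial>\<omega>)
      \<le> (\<integral>\<^sup>+x. ennreal (16 ^ N) * (\<Sum>a\<in>UNIV. (W a x)\<^sup>2) \<partial>\<omega>)"
  proof (rule nn_integral_mono)
    fix x
    obtain a where "maximal_function (weighted f \<sigma>) x \<le> ennreal (4 ^ N) * W a x"
      using maximal_function_le_grid_maximal[OF ss(1) f] unfolding W_def F_def N_def by blast
    then have "(maximal_function (weighted f \<sigma>) x)\<^sup>2 \<le> (ennreal (4 ^ N) * W a x)\<^sup>2"
      by (intro power_mono) auto
    also have "\<dots> = ennreal (16 ^ N) * (W a x)\<^sup>2"
    proof -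
      have "((4 ^ N)\<^sup>2 :: real) = 16 ^ N" by (simp add: power_mult[symmetric] mult.commute[of _ 2] power_mult)
      then show ?thesis by (simp add: power_mult_distrib ennreal_power)
    qed
    also have "\<dots> \<le> ennreal (16 ^ N) * (\<Sum>a\<in>UNIV. (W a x)\<^sup>2)"
      by (intro mult_left_mono member_le_sum) auto
    finally show "(maximal_function (weighted f \<sigma>) x)\<^sup>2 \<le> ennreal (16 ^ N) * (\<Sum>a\<in>UNIV. (W a x)\<^sup>2)" .
  qed
  also have "\<dots> = ennreal (16 ^ N) * (\<Sum>a\<in>UNIV. (\<integral>\<^sup>+x. (W a x)\<^sup>2 \<partial>\<omega>))"
    using W_meas by (simp add: nn_integral_cmult nn_integral_sum)
  also have "\<dots> \<le> ennreal (16 ^ N) * (\<Sum>a\<in>(UNIV :: ('n \<Rightarrow> bool) set). 32 * ennreal B * (\<integral>\<^sup>+x. (F x)\<^sup>2 \<partial>\<sigma>))"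
    by (intro mult_left_mono sum_mono W_bound) auto
  also have "\<dots> = ennreal (16 ^ N) * (ennreal (2 ^ N) * (ennreal 32 * ennreal B)) * (\<integral>\<^sup>+x. (F x)\<^sup>2 \<partial>\<sigma>)"
    by (simp add: card_fun N_def mult.assoc ennreal_power[symmetric])
  also have "ennreal (16 ^ N) * (ennreal (2 ^ N) * (ennreal 32 * ennreal B)) = ennreal (16 ^ N * (2 ^ N * (32 * B)))"
    by (simp only: ennreal_mult'[symmetric] ennreal_mult''[symmetric]) (simp add: ennreal_mult B_def)
  also have "16 ^ N * (2 ^ N * (32 * B)) = 512 * 32 ^ N * ((2 ^ g) ^ N)\<^sup>2 * T\<^sup>2"
  proof -
    have "(16 ^ N * 2 ^ N :: real) = 32 ^ N" by (simp add: power_mult_distrib[symmetric])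
    then show ?thesis unfolding B_def by (simp add: mult.assoc[symmetric])
  qed
  finally show ?thesis unfolding F2 N_def .
qed

lemma indicator_testing_of_norm_bound:
  fixes \<sigma> \<omega> :: "(real ^ 'n) measure"
  assumes lf: "locally_finite_borel \<sigma>"
    and norm: "\<And>f. f \<in> L2 \<sigma> \<Longrightarrow> (\<integral>\<^sup>+x. (maximal_function (weighted f \<sigma>) x)\<^sup>2 \<partial>\<omega>)
                   \<le> ennreal (C\<^sup>2) * (\<integral>\<^sup>+x. ennreal (\<bar>f x\<bar>\<^sup>2) \<partial>\<sigma>)"
  shows "(\<integral>\<^sup>+x\<in>cube c l. (maximal_function (weighted (indicator (cube c l)) \<sigma>) x)\<^sup>2 \<partial>\<omega>)
           \<le> ennreal (C\<^sup>2) * emeasure \<sigma> (cube c l)"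
proof -
  let ?K = "cube c l"
  have s: "sets \<sigma> = sets borel" using lf by (simp add: locally_finite_borel_def)
  have K: "?K \<in> sets \<sigma>" by (simp add: s)
  have sq: "(\<lambda>x. \<bar>indicator ?K x :: real\<bar>\<^sup>2) = indicator ?K" by (auto simp: indicator_def)
  have "(indicator ?K :: _ \<Rightarrow> real) \<in> L2 \<sigma>"
    unfolding L2_def
  proof (intro CollectI conjI)
    show "(indicator ?K :: _ \<Rightarrow> real) \<in> borel_measurable \<sigma>"
      using K by (rule borel_measurable_indicator)
    show "integrable \<sigma> (\<lambda>x. \<bar>indicator ?K x :: real\<bar>\<^sup>2)"
      unfolding sq by (rule integrable_real_indicator[OF K emeasure_cube_finite[OF lf]])
  qed
  then have "(\<integral>\<^sup>+x. (maximal_function (weighted (indicator ?K) \<sigma>) x)\<^sup>2 \<partial>\<omega>)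
      \<le> ennreal (C\<^sup>2) * (\<integral>\<^sup>+x. ennreal (\<bar>indicator ?K x\<bar>\<^sup>2) \<partial>\<sigma>)" by (rule norm)
  also have "(\<integral>\<^sup>+x. ennreal (\<bar>indicator ?K x\<bar>\<^sup>2) \<partial>\<sigma>) = (\<integral>\<^sup>+x. indicator ?K x \<partial>\<sigma>)"
    by (rule nn_integral_cong) (auto simp: indicator_def)
  also have "\<dots> = emeasure \<sigma> ?K" using K by simp
  finally have "(\<integral>\<^sup>+x. (maximal_function (weighted (indicator ?K) \<sigma>) x)\<^sup>2 \<partial>\<omega>) \<le> ennreal (C\<^sup>2) * emeasure \<sigma> ?K" .
  moreover have "(\<integral>\<^sup>+x\<in>?K. (maximal_function (weighted (indicator ?K) \<sigma>) x)\<^sup>2 \<partial>\<omega>)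
      \<le> (\<integral>\<^sup>+x. (maximal_function (weighted (indicator ?K) \<sigma>) x)\<^sup>2 \<partial>\<omega>)"
    by (rule nn_integral_mono) (auto simp: indicator_def)
  ultimately show ?thesis by (rule order_trans[rotated])
qed

text \<open>On \<open>Q\<close> the maximal function of \<open>1\<^sub>Q \<sigma>\<close> is at least \<open>\<sigma>(Q) / |Q|\<close>; then divide by \<open>\<sigma>(Q)\<close>, the case of
  \<open>\<sigma>(Q) = 0\<close> being trivial.\<close>

lemma A2_const_le_of_undilated_testing:
  fixes \<sigma> \<omega> :: "(real ^ 'n) measure"
  assumes lf: "locally_finite_borel \<sigma>" "locally_finite_borel \<omega>"
    and testing: "\<And>(c :: real ^ 'n) k.
        (\<integral>\<^sup>+x\<in>cube c (2 powi k). (maximal_function (weighted (indicator (cube c (2 powi k))) \<sigma>) x)\<^sup>2 \<partial>\<omega>)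
          \<le> ennreal (C\<^sup>2) * emeasure \<sigma> (cube c (2 powi k))"
  shows "A2_const \<sigma> \<omega> \<le> ennreal (C\<^sup>2)"
  unfolding A2_const_def
proof (rule SUP_least)
  fix Q :: "(real ^ 'n) set" assume Q: "Q \<in> pow2_cubes"
  then obtain c k where Qc: "Q = cube c (2 powi k)" by (rule pow2_cubesE)
  have s: "sets \<omega> = sets borel" using lf by (simp add: locally_finite_borel_def)
  have Qb: "Q \<in> sets borel" unfolding Qc by simp
  define v where "v = measure lborel Q"
  have v: "emeasure lborel Q = ennreal v" "v > 0"
    unfolding v_def Qc using emeasure_lborel_cube[of "2 powi k" c] by (auto simp: measure_def)
  obtain t where t: "emeasure \<sigma> Q = ennreal t" "0 \<le> t"
    using emeasure_cube_finite[OF lf(1), of c "2 powi k"] unfolding Qc by (cases "emeasure \<sigma> (cube c (2 powi k))") auto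
  obtain w where w: "emeasure \<omega> Q = ennreal w" "0 \<le> w"
    using emeasure_cube_finite[OF lf(2), of c "2 powi k"] unfolding Qc by (cases "emeasure \<omega> (cube c (2 powi k))") auto
  have "(ennreal (t / v))\<^sup>2 * emeasure \<omega> Q = (\<integral>\<^sup>+x\<in>Q. (ennreal (t / v))\<^sup>2 \<partial>\<omega>)"
    using Qb s by (simp add: nn_integral_cmult_indicator)
  also have "\<dots> \<le> (\<integral>\<^sup>+x\<in>Q. (maximal_function (weighted (indicator Q) \<sigma>) x)\<^sup>2 \<partial>\<omega>)"
  proof (rule nn_integral_mono)
    fix x
    have "ennreal (t / v) \<le> maximal_function (weighted (indicator Q) \<sigma>) x" if "x \<in> Q"
      using maximal_function_indicator_ge[OF lf(1) Q that order_refl Qb] v t by (simp add: divide_ennreal)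
    then show "(ennreal (t / v))\<^sup>2 * indicator Q x \<le> (maximal_function (weighted (indicator Q) \<sigma>) x)\<^sup>2 * indicator Q x"
      by (auto simp: indicator_def intro!: power_mono)
  qed
  also have "\<dots> \<le> ennreal (C\<^sup>2) * emeasure \<sigma> Q" unfolding Qc by (rule testing)
  finally have "(t / v)\<^sup>2 * w \<le> C\<^sup>2 * t"
    unfolding t w using t(2) w(2) v(2) by (simp add: ennreal_power ennreal_mult[symmetric])
  then have "t * (t / v * (w / v)) \<le> t * C\<^sup>2" by (simp add: power2_eq_square mult_ac)
  then have "t / v * (w / v) \<le> C\<^sup>2" if "t > 0"
    using that by (rule mult_left_le_imp_le)
  moreover have "t / v * (w / v) \<le> C\<^sup>2" if "t = 0" using that by simp
  ultimately have "t / v * (w / v) \<le> C\<^sup>2" using t(2) by linarith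
  then show "emeasure \<sigma> Q / emeasure lborel Q * (emeasure \<omega> Q / emeasure lborel Q) \<le> ennreal (C\<^sup>2)"
    unfolding t w v using t(2) w(2) v(2) by (simp add: divide_ennreal ennreal_mult[symmetric])
qed

theorem theorem2:
  fixes \<Gamma> :: real
  assumes "\<Gamma> > 1"
  shows "\<exists>C::real. C \<ge> 1 \<and>
    (\<forall>\<sigma> \<omega> :: (real ^ 'n) measure. locally_finite_borel \<sigma> \<longrightarrow> locally_finite_borel \<omega> \<longrightarrow>
       ennreal (1 / C) * norm_const \<sigma> \<omega> \<le> testing_const \<Gamma> \<sigma> \<omega> + ennreal_sqrt (A2_const \<sigma> \<omega>) \<and>
       testing_const \<Gamma> \<sigma> \<omega> + ennreal_sqrt (A2_const \<sigma> \<omega>) \<le> ennreal C * norm_const \<sigma> \<omega>)"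
proof -
  obtain g where g: "\<Gamma> \<le> 2 ^ g" using real_arch_pow[of 2 \<Gamma>] by (auto intro: less_imp_le)
  define H :: real where "H = 512 * 32 ^ CARD('n) * ((2 ^ g) ^ CARD('n))\<^sup>2"
  define C where "C = sqrt H + 2"
  have H: "H \<ge> 0" by (simp add: H_def)
  then have C: "C \<ge> 2" "C \<ge> sqrt H" by (simp_all add: C_def)
  have main: "ennreal (1 / C) * norm_const \<sigma> \<omega> \<le> testing_const \<Gamma> \<sigma> \<omega> + ennreal_sqrt (A2_const \<sigma> \<omega>)"
    if lf: "locally_finite_borel \<sigma>" "locally_finite_borel \<omega>" for \<sigma> \<omega> :: "(real ^ 'n) measure"
  proof (cases "A2_const \<sigma> \<omega> = \<infinity>")
    case True
    then show ?thesis by (simp add: ennreal_sqrt_def)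
  next
    case False
    have "ennreal (1 / C) * norm_const \<sigma> \<omega> \<le> testing_const \<Gamma> \<sigma> \<omega>"
      unfolding testing_const_def
    proof (rule Inf_greatest)
      fix t assume "t \<in> {ennreal C |C. 0 \<le> C \<and> (\<forall>(c :: real ^ 'n) k. let Q = cube c (2 powi k) in
        (\<integral>\<^sup>+x\<in>Q. (maximal_function (weighted (indicator Q) \<sigma>) x)\<^sup>2 \<partial>\<omega>) \<le> ennreal (C\<^sup>2) * emeasure \<sigma> (cube c (\<Gamma> * 2 powi k)))}"
      then obtain T where T: "t = ennreal T" "0 \<le> T"
        and testing: "\<And>(c :: real ^ 'n) k.
        (\<integral>\<^sup>+x\<in>cube c (2 powi k). (maximal_function (weighted (indicator (cube c (2 powi k))) \<sigma>) x)\<^sup>2 \<partial>\<omega>)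
          \<le> ennreal (T\<^sup>2) * emeasure \<sigma> (cube c (\<Gamma> * 2 powi k))"
        by (auto simp: Let_def)
      have sq: "(sqrt H * T)\<^sup>2 = H * T\<^sup>2" using H by (simp add: power_mult_distrib)
      have "norm_const \<sigma> \<omega> \<le> ennreal (sqrt H * T)"
        unfolding norm_const_def
      proof (rule Inf_lower, rule CollectI, intro exI[of _ "sqrt H * T"] conjI ballI refl)
        show "0 \<le> sqrt H * T" using H T by simp
        fix f assume "f \<in> L2 \<sigma>"
        then have f: "f \<in> borel_measurable \<sigma>" by (simp add: L2_def)
        show "(\<integral>\<^sup>+x. (maximal_function (weighted f \<sigma>) x)\<^sup>2 \<partial>\<omega>)
            \<le> ennreal ((sqrt H * T)\<^sup>2) * (\<integral>\<^sup>+x. ennreal (\<bar>f x\<bar>\<^sup>2) \<partial>\<sigma>)"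
          unfolding sq using norm_bound_of_dilated_testing[OF lf False testing g f]
          by (simp only: H_def)
      qed
      then have "ennreal (1 / C) * norm_const \<sigma> \<omega> \<le> ennreal (1 / C) * ennreal (sqrt H * T)"
        by (rule mult_left_mono) simp
      also have "\<dots> = ennreal (1 / C * (sqrt H * T))" using C H T by (simp add: ennreal_mult[symmetric])
      also have "\<dots> \<le> t" unfolding T
      proof (rule ennreal_leI)
        have "sqrt H * T \<le> C * T" using C T by (intro mult_right_mono) auto
        then show "1 / C * (sqrt H * T) \<le> T" using C by (simp add: field_simps)
      qed
      finally show "ennreal (1 / C) * norm_const \<sigma> \<omega> \<le> t" .
    qed
    then show ?thesis by (rule order_trans) simp
  qed
  have converse: "testing_const \<Gamma> \<sigma> \<omega> + ennreal_sqrt (A2_const \<sigma> \<omega>) \<le> ennreal C * norm_const \<sigma> \<omega>"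
    if lf: "locally_finite_borel \<sigma>" "locally_finite_borel \<omega>" for \<sigma> \<omega> :: "(real ^ 'n) measure"
  proof -
    have bounds: "testing_const \<Gamma> \<sigma> \<omega> \<le> ennreal B \<and> ennreal_sqrt (A2_const \<sigma> \<omega>) \<le> ennreal B"
      if B: "0 \<le> B" and norm: "\<forall>f\<in>L2 \<sigma>. (\<integral>\<^sup>+x. (maximal_function (weighted f \<sigma>) x)\<^sup>2 \<partial>\<omega>)
                   \<le> ennreal (B\<^sup>2) * (\<integral>\<^sup>+x. ennreal (\<bar>f x\<bar>\<^sup>2) \<partial>\<sigma>)" for B
    proof
      have testing: "(\<integral>\<^sup>+x\<in>cube c (2 powi k). (maximal_function (weighted (indicator (cube c (2 powi k))) \<sigma>) x)\<^sup>2 \<partial>\<omega>)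
          \<le> ennreal (B\<^sup>2) * emeasure \<sigma> (cube c (2 powi k))" for c :: "real ^ 'n" and k
        using norm by (intro indicator_testing_of_norm_bound[OF lf(1)]) auto
      show "testing_const \<Gamma> \<sigma> \<omega> \<le> ennreal B"
        unfolding testing_const_def
      proof (rule Inf_lower, rule CollectI, intro exI[of _ B] conjI allI refl B, unfold Let_def)
        fix c :: "real ^ 'n" and k :: int
        have "emeasure \<sigma> (cube c (2 powi k)) \<le> emeasure \<sigma> (cube c (\<Gamma> * 2 powi k))"
          using assms lf by (intro emeasure_mono cube_mono) (auto simp: locally_finite_borel_def)
        then show "(\<integral>\<^sup>+x\<in>cube c (2 powi k). (maximal_function (weighted (indicator (cube c (2 powi k))) \<sigma>) x)\<^sup>2 \<partial>\<omega>)
          \<le> ennreal (B\<^sup>2) * emeasure \<sigma> (cube c (\<Gamma> * 2 powi k))"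
          by (intro order_trans[OF testing] mult_left_mono) auto
      qed
      have "A2_const \<sigma> \<omega> \<le> ennreal (B\<^sup>2)" by (rule A2_const_le_of_undilated_testing[OF lf testing])
      then obtain A where A: "A2_const \<sigma> \<omega> = ennreal A" "0 \<le> A" "A \<le> B\<^sup>2"
        by (cases "A2_const \<sigma> \<omega>") (auto simp: top_unique)
      then have "sqrt A \<le> B" using B by (simp add: real_le_lsqrt)
      then show "ennreal_sqrt (A2_const \<sigma> \<omega>) \<le> ennreal B"
        using A by (simp add: ennreal_sqrt_def ennreal_leI)
    qed
    have T: "testing_const \<Gamma> \<sigma> \<omega> \<le> norm_const \<sigma> \<omega>" and A: "ennreal_sqrt (A2_const \<sigma> \<omega>) \<le> norm_const \<sigma> \<omega>"
      unfolding norm_const_def using bounds by (auto intro!: Inf_greatest)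
    have "testing_const \<Gamma> \<sigma> \<omega> + ennreal_sqrt (A2_const \<sigma> \<omega>) \<le> norm_const \<sigma> \<omega> + norm_const \<sigma> \<omega>"
      using T A by (rule add_mono)
    also have "\<dots> = ennreal 2 * norm_const \<sigma> \<omega>" by (simp add: mult_2)
    also have "\<dots> \<le> ennreal C * norm_const \<sigma> \<omega>"
      using C by (intro mult_right_mono ennreal_leI) auto
    finally show ?thesis .
  qed
  show ?thesis
    using main converse C by (intro exI[of _ C] conjI allI impI) auto
qed

end
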